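(* Let $T=\{0,1/2,1/3,\ldots,1/n,\ldots\}$. Let $\{\lambda_j\}_{j\ge 2}$, $\{f_j\}_{j\ge 2}$, $\{g_j\}_{j\ge 2}$ be real sequences with $\lambda_j>0$, $0<f_j<1$, $0<g_j<1$ for all $j\ge 2$, $\lim_{n\to\infty}\lambda_n=0$, and $$\sum_{j=2}^{\infty}\frac{1-f_j}{\lambda_j}<1,\qquad \sum_{j=2}^{\infty}\frac{1-g_j}{\lambda_j}<1 .$$ Let $U$ be the kernel on $T$ defined by $U(0,0)=2$, $U(0,1/j)=1+g_j$, $U(1/i,0)=1+f_i$ and $U(1/i,1/j)=\lambda_i\delta_{i,j}+1+f_ig_j$ for $i,j\ge 2$. For $\alpha>0$ let $X_{(\alpha)}=\{X_{(\alpha),s},\,s\in T\}$ be an $\alpha$-permanental sequence with kernel $U$. If $$\lim_{n\to\infty}\lambda_n\log n=\beta,\qquad 0\le\beta<\infty,$$ then for all integers $k\ge 1$, almost surely, $$\limsup_{n\to\infty}\frac{|X^{1/2}_{(k/2),1/n}-X^{1/2}_{(k/2),0}|}{(\lambda_n\log n)^{1/2}}=1,\qquad \limsup_{n\to\infty}\frac{X^{1/2}_{(k/2),1/n}-X^{1/2}_{(k/2),0}}{(\lambda_n\log n)^{1/2}}=1,$$ and $$\liminf_{n\to\infty}\frac{X^{1/2}_{(k/2),1/n}-X^{1/2}_{(k/2),0}}{(\lambda_n\log n)^{1/2}}=-\left(\frac{X^{1/2}_{(k/2),0}}{\beta^{1/2}}\wedge 1\right),$$ where for $\beta=0$ the right-hand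 side of the last display is read as $-1$.
   Context: Here $a\wedge b=\min(a,b)$. An $\alpha$-permanental vector with kernel $K$ (an $n\times n$ matrix), $\alpha>0$, is a random vector $(X_1,\ldots,X_n)$ with values in $[0,\infty)^n$ such that for every diagonal matrix $S$ with non-negative diagonal entries $s_1,\ldots,s_n$, $$E\Big(e^{-\sum_{i=1}^n s_iX_i}\Big)=\frac{1}{|I+KS|^{\alpha}},$$ where $|\cdot|$ denotes the determinant. An $\alpha$-permanental process (sequence) on $T$ with kernel $\{K(s,t);s,t\in T\}$ is a stochastic process $\{X_t,t\in T\}$ such that for all distinct $t_1,\ldots,t_n\in T$, $(X_{t_1},\ldots,X_{t_n})$ is an $\alpha$-permanental vector with kernel $\{K(t_i,t_j)\}_{i,j=1}^n$. For the kernel $U$ of the claim, such a sequence exists for every $\alpha>0$. *)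

theory Defs
  imports "HOL-Probability.Probability" "Jordan_Normal_Form.Determinant"
begin

text \<open>
  The matrix \<open>K\<close> is \<open>n \<times> n\<close>, with rows and columns indexed by \<open>0, \<dots>, n - 1\<close>; only \<open>X 0, \<dots>, X (n - 1)\<close>
  matter. Positivity of the determinant need not be required separately: the left-hand side is
  positive, so the determinant never vanishes, and it is continuous in \<open>s\<close> with value 1 at \<open>s = 0\<close>.
\<close>

definition permanental_vector ::
  "'w measure \<Rightarrow> real \<Rightarrow> nat \<Rightarrow> real mat \<Rightarrow> (nat \<Rightarrow> 'w \<Rightarrow> real) \<Rightarrow> bool" where
  "permanental_vector M \<alpha> n K X \<longleftrightarrow>
     prob_space M \<and> \<alpha> > 0 \<and> K \<in> carrier_mat n n \<and>
     (\<forall>i<n. X i \<in> borel_measurable M \<and> (\<forall>w\<in>space M. X i w \<ge> 0)) \<and>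
     (\<forall>s :: nat \<Rightarrow> real. (\<forall>i<n. s i \<ge> 0) \<longrightarrow>
        prob_space.expectation M (\<lambda>w. exp (- (\<Sum>i<n. s i * X i w))) =
          1 / Determinant.det (1\<^sub>m n + K * mat_diag n s) powr \<alpha>)"

definition permanental_process ::
  "'w measure \<Rightarrow> real \<Rightarrow> 't set \<Rightarrow> ('t \<Rightarrow> 't \<Rightarrow> real) \<Rightarrow> ('t \<Rightarrow> 'w \<Rightarrow> real) \<Rightarrow> bool" where
  "permanental_process M \<alpha> T K X \<longleftrightarrow>
     (\<forall>ts. distinct ts \<and> set ts \<subseteq> T \<longrightarrow>
        permanental_vector M \<alpha> (length ts)
          (Matrix.mat (length ts) (length ts) (\<lambda>(i, j). K (ts ! i) (ts ! j)))
          (\<lambda>i. X (ts ! i)))"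

end

theory Submission
  imports Defs
begin

text \<open>
  With \<open>a\<^sub>i = s\<^sub>i / (1 + \<lambda>\<^sub>i s\<^sub>i)\<close>, \<open>p = 1 - f\<close>, \<open>q = 1 - g\<close> and \<open>A = \<Sum> a\<^sub>i\<close>, the kernel being a diagonal matrix
  plus one of rank two gives \<open>det (I + U S) = (\<Prod> (1 + \<lambda>\<^sub>i s\<^sub>i)) (1 + 2 A) (1 - Y)\<close>, where \<open>Y\<close> is a polynomial in
  \<open>1 / (1 + 2 A)\<close> and in the sums \<open>\<Sum> a\<^sub>i p\<^sub>i\<close>, \<open>\<Sum> a\<^sub>i q\<^sub>i\<close>, \<open>\<Sum> a\<^sub>i p\<^sub>i q\<^sub>i\<close>. Only a tail of the index set matters, so these
  sums may be taken small. The factor \<open>(1 + 2 A) powr -(\<alpha> + j) * (\<Prod> (1 + \<lambda>\<^sub>i s\<^sub>i)) powr -\<alpha>\<close>, with \<open>\<alpha> = k / 2\<close>, is the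
  Laplace transform of an explicit process: \<open>X\<^sub>0 = z\<close> is gamma distributed and, given \<open>z\<close>, the other
  coordinates are independent noncentral chi-square variables; for it the claim follows from the
  Borel--Cantelli lemmas. Since \<open>a\<^sub>i p\<^sub>i = (p\<^sub>i / \<lambda>\<^sub>i) (1 - 1 / (1 + \<lambda>\<^sub>i s\<^sub>i))\<close>, multiplying by \<open>Y\<close> only mixes in,
  with signs and summable weights, processes in which independent exponential variables are added
  to finitely many coordinates, and that does not affect the upper and lower limits. Expanding
  \<open>(1 - Y) powr -\<alpha>\<close> in a binomial series thus writes the law of \<open>X\<close> as an absolutely convergent signed
  mixture of laws for which the claim holds almost surely.
\<close>

section \<open>Uniqueness of signed Laplace transforms\<close>

text \<open>The kernel need not be symmetric, so \<open>X\<close> cannot be treated as a sum of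
  squared Gaussian processes; what is at hand is its Laplace transform. For f = g = 1 the kernel is
  a diagonal plus the constant 2, and with \<alpha> = k / 2 the process is half the squared length
  of a k-dimensional Gaussian vector. Rotating the common part of these vectors onto the first axis
  gives the explicit process, in which the common part enters only through its squared length z. A
  factor 1 / (1 + 2 A) in Y then does no harm: it raises the gamma shape of z by one and leaves the
  conditional law given z alone. The remaining terms of Y have both signs, so the mixture is signed.
  Signs are harmless because an event that is null for every component is null for the mixture, and
  a signed measure is determined by its Laplace transform. What has to be controlled is the total
  variation of the whole series: the tail sums are taken so small that multiplication by Y costs at
  most a factor 1 / 2, inside the radius of convergence of the binomial series.\<close>

text \<open>A Dynkin-class argument that survives signed densities: complements use
  \<open>total\<close>, disjoint unions use dominated convergence with the absolute density as
  majorant. The two sides live on unrelated spaces, so \<open>complement\<close> and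
  \<open>unions\<close> are shown for arbitrary \<open>u\<close>, \<open>R\<close>, \<open>Z\<close>
  and applied to both.\<close>

lemma integral_indicator_eq_generator:
  fixes v :: "'a \<Rightarrow> real" and w :: "'b \<Rightarrow> real" and N :: "'c measure"
  assumes v: "integrable P v" and w: "integrable Q w"
    and X: "X \<in> measurable P N" and Y: "Y \<in> measurable Q N"
    and G: "sets N = sigma_sets (space N) G" "Int_stable G" "G \<subseteq> Pow (space N)"
    and total: "(\<integral>x. v x \<partial>P) = (\<integral>x. w x \<partial>Q)"
    and gen: "\<And>A. A \<in> G \<Longrightarrow> (\<integral>x. v x * indicator A (X x) \<partial>P) = (\<integral>x. w x * indicator A (Y x) \<partial>Q)"
    and A: "A \<in> sets N"
  shows "(\<integral>x. v x * indicator A (X x) \<partial>P) = (\<integral>x. w x * indicator A (Y x) \<partial>Q)"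
proof -
  have complement: "(\<integral>x. u x * indicator (space N - A) (Z x) \<partial>R) = (\<integral>x. u x \<partial>R) - (\<integral>x. u x * indicator A (Z x) \<partial>R)"
    if u: "integrable R u" and Z: "Z \<in> measurable R N" and A: "A \<in> sets N"
    for u :: "'d \<Rightarrow> real" and R :: "'d measure" and Z A
  proof -
    have i: "integrable R (\<lambda>x. u x * indicator A (Z x))"
      using u Z A by (intro integrable_real_mult_indicator[OF _ u, of "Z -` A \<inter> space R", THEN Bochner_Integration.integrable_cong[THEN iffD1, rotated -1]])
         (auto simp: indicator_def)
    have "(\<integral>x. u x * indicator (space N - A) (Z x) \<partial>R) = (\<integral>x. u x - u x * indicator A (Z x) \<partial>R)"
      using measurable_space[OF Z] by (intro Bochner_Integration.integral_cong) (auto simp: indicator_def)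
    with i u show ?thesis by simp
  qed
  have unions: "(\<lambda>n. \<Sum>i<n. \<integral>x. u x * indicator (A i) (Z x) \<partial>R) \<longlonglongrightarrow> (\<integral>x. u x * indicator (\<Union>i. A i) (Z x) \<partial>R)"
    if u: "integrable R u" and Z: "Z \<in> measurable R N" and A: "\<And>i. A i \<in> sets N" and d: "disjoint_family A"
    for u :: "'d \<Rightarrow> real" and R :: "'d measure" and Z and A :: "nat \<Rightarrow> _"
  proof -
    have um[measurable]: "u \<in> borel_measurable R" using u by auto
    note Z[measurable] A[measurable]
    have i: "integrable R (\<lambda>x. u x * indicator (A i) (Z x))" for i
      by (rule Bochner_Integration.integrable_bound[OF u]) (auto simp: indicator_def)
    have e: "(\<Sum>i<n. indicator (A i) y) = (indicator (\<Union>i<n. A i) y :: real)" for n y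
      using d by (subst indicator_UN_disjoint) (auto intro: disjoint_family_on_mono)
    have "(\<lambda>n. \<integral>x. u x * indicator (\<Union>i<n. A i) (Z x) \<partial>R) \<longlonglongrightarrow> (\<integral>x. u x * indicator (\<Union>i. A i) (Z x) \<partial>R)"
    proof (rule integral_dominated_convergence[where w="\<lambda>x. \<bar>u x\<bar>"])
      show "AE x in R. (\<lambda>n. u x * indicator (\<Union>i<n. A i) (Z x)) \<longlonglongrightarrow> u x * indicator (\<Union>i. A i) (Z x)"
        by (intro AE_I2 tendsto_mult tendsto_const LIMSEQ_indicator_UN)
    qed (use u in \<open>auto simp: indicator_def\<close>)
    moreover have "(\<integral>x. u x * indicator (\<Union>i<n. A i) (Z x) \<partial>R) = (\<Sum>i<n. \<integral>x. u x * indicator (A i) (Z x) \<partial>R)" for n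
      using i by (subst Bochner_Integration.integral_sum[symmetric]) (auto simp: sum_distrib_left[symmetric] e)
    ultimately show ?thesis by simp
  qed
  have A': "A \<in> sigma_sets (space N) G" using A G by simp
  show ?thesis using A'
  proof (induction rule: sigma_sets_induct_disjoint[OF G(2,3), consumes 1, case_names basic empty compl union])
    case (compl A)
    then have "A \<in> sets N" using G by simp
    then show ?case using complement[OF v X] complement[OF w Y] compl(2) total by (simp add: \<open>A \<in> sets N\<close>)
  next
    case (union A)
    then have m: "A i \<in> sets N" for i using G by auto
    show ?case
      using LIMSEQ_unique[OF unions[OF v X m union(1)]] unions[OF w Y m union(1)] union(3) by simp
  qed (use gen in auto)
qed

text \<open>On the unit interval polynomials are uniformly dense in the continuous functions,
  indicators of closed half-lines are pointwise limits of these, and half-lines generate the Borel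
  sets.\<close>

lemma integral_indicator_eq_of_moments:
  fixes v :: "'a \<Rightarrow> real" and w :: "'b \<Rightarrow> real"
  assumes v: "integrable P v" and w: "integrable Q w"
    and X: "X \<in> borel_measurable P" and Y: "Y \<in> borel_measurable Q"
    and X01: "\<And>x. x \<in> space P \<Longrightarrow> X x \<in> {0..1::real}" and Y01: "\<And>x. x \<in> space Q \<Longrightarrow> Y x \<in> {0..1}"
    and moments: "\<And>m. (\<integral>x. v x * X x ^ m \<partial>P) = (\<integral>x. w x * Y x ^ m \<partial>Q)"
    and A: "A \<in> sets borel"
  shows "(\<integral>x. v x * indicator A (X x) \<partial>P) = (\<integral>x. w x * indicator A (Y x) \<partial>Q)"
proof -
  have int: "integrable R (\<lambda>x. u x * h (Z x))"
    if "integrable R u" "Z \<in> borel_measurable R" "\<And>x. x \<in> space R \<Longrightarrow> Z x \<in> {0..1}" "continuous_on UNIV h"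
    for R :: "'c measure" and u Z and h :: "real \<Rightarrow> real"
  proof -
    have "compact (h ` {0..1})" using that(4) by (intro compact_continuous_image continuous_on_subset[OF that(4)]) auto
    then obtain B where B: "\<And>y. y \<in> {0..1} \<Longrightarrow> \<bar>h y\<bar> \<le> B" 
      using compact_imp_bounded bounded_iff[of "h ` {0..1}"] by (metis image_eqI real_norm_def)
    have [measurable]: "h \<in> borel_measurable borel" "u \<in> borel_measurable R" "Z \<in> borel_measurable R"
      using that by (auto intro: borel_measurable_continuous_onI)
    show ?thesis
      by (rule Bochner_Integration.integrable_bound[of _ "\<lambda>x. B * u x"])
        (use that(1) B[OF that(3)] in \<open>auto simp: abs_mult mult.commute[of B] intro!: AE_I2 mult_left_mono intro: order_trans[OF _ abs_ge_self]\<close>)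
  qed
  have poly: "(\<integral>x. v x * p (X x) \<partial>P) = (\<integral>x. w x * p (Y x) \<partial>Q)" if "real_polynomial_function p" for p
  proof -
    obtain a n where p: "p = (\<lambda>x. \<Sum>i\<le>n. a i * x ^ i)" using \<open>real_polynomial_function p\<close> real_polynomial_function_iff_sum by blast
    have "(\<integral>x. u x * p (Z x) \<partial>R) = (\<Sum>i\<le>n. a i * (\<integral>x. u x * Z x ^ i \<partial>R))"
      if "integrable R u" "Z \<in> borel_measurable R" "\<And>x. x \<in> space R \<Longrightarrow> Z x \<in> {0..1}" for R :: "'c measure" and u Z
    proof -
      have "integrable R (\<lambda>x. u x * Z x ^ i)" for i
        using int[OF that, of "\<lambda>y. y ^ i"] continuous_on_power[OF continuous_on_id, of UNIV i] by simp
      then have "(\<integral>x. (\<Sum>i\<le>n. a i * (u x * Z x ^ i)) \<partial>R) = (\<Sum>i\<le>n. a i * (\<integral>x. u x * Z x ^ i \<partial>R))"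
        by (subst Bochner_Integration.integral_sum) auto
      then show ?thesis by (simp add: p sum_distrib_left mult_ac)
    qed
    from this[OF v X X01] this[OF w Y Y01] moments show ?thesis by simp
  qed
  have cont: "(\<integral>x. v x * h (X x) \<partial>P) = (\<integral>x. w x * h (Y x) \<partial>Q)" if h: "continuous_on UNIV h" for h
  proof -
    \<comment> \<open>The total mass that turns a uniform error into an error of the integrals;
      dividing by \<open>K + 1\<close> stays safe when both densities vanish.\<close>
    define K where "K = (\<integral>x. \<bar>v x\<bar> \<partial>P) + (\<integral>x. \<bar>w x\<bar> \<partial>Q)"
    have K0: "K \<ge> 0" unfolding K_def by (intro add_nonneg_nonneg integral_nonneg_AE) auto
    have "\<bar>(\<integral>x. v x * h (X x) \<partial>P) - (\<integral>x. w x * h (Y x) \<partial>Q)\<bar> \<le> e" if e: "e > 0" for e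
    proof -
      define e' where "e' = e / (K + 1)"
      have e': "e' > 0" "e' * K \<le> e" using e K0 unfolding e'_def by (auto simp: field_simps)
      have hc: "continuous_on {0..1} h" using h continuous_on_subset by blast
      obtain p where p: "real_polynomial_function p" "\<And>x. x \<in> {0..1} \<Longrightarrow> \<bar>h x - p x\<bar> < e'"
        using Stone_Weierstrass_real_polynomial_function[OF _ hc e'(1)] by auto
      have pc: "continuous_on UNIV p" using p(1) continuous_on_polymonial_function real_polynomial_function_eq by blast
      have *: "\<bar>(\<integral>x. u x * h (Z x) \<partial>R) - (\<integral>x. u x * p (Z x) \<partial>R)\<bar> \<le> e' * (\<integral>x. \<bar>u x\<bar> \<partial>R)"
        if a: "integrable R u" "Z \<in> borel_measurable R" "\<And>x. x \<in> space R \<Longrightarrow> Z x \<in> {0..1}" for R :: "'c measure" and u Z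
      proof -
        have "\<bar>(\<integral>x. u x * h (Z x) \<partial>R) - (\<integral>x. u x * p (Z x) \<partial>R)\<bar> = \<bar>\<integral>x. u x * h (Z x) - u x * p (Z x) \<partial>R\<bar>"
          using int[OF a h] int[OF a pc] by simp
        also have "\<dots> \<le> (\<integral>x. \<bar>u x * h (Z x) - u x * p (Z x)\<bar> \<partial>R)" by (rule integral_abs_bound)
        also have "\<dots> \<le> (\<integral>x. e' * \<bar>u x\<bar> \<partial>R)"
        proof (rule integral_mono)
          fix x assume "x \<in> space R"
          then show "\<bar>u x * h (Z x) - u x * p (Z x)\<bar> \<le> e' * \<bar>u x\<bar>"
            using p(2)[OF a(3)] mult_left_mono[of "\<bar>h (Z x) - p (Z x)\<bar>" e' "\<bar>u x\<bar>"]
            by (force simp: right_diff_distrib[symmetric] abs_mult mult.commute less_imp_le)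
        qed (use int[OF a h] int[OF a pc] a(1) in auto)
        finally show ?thesis using a(1) by simp
      qed
      have "e' * (\<integral>x. \<bar>v x\<bar> \<partial>P) + e' * (\<integral>x. \<bar>w x\<bar> \<partial>Q) \<le> e" using e'(2) by (simp add: K_def distrib_left)
      then show ?thesis using *[OF v X X01] *[OF w Y Y01] poly[OF p(1)] by linarith
    qed
    then have "\<bar>(\<integral>x. v x * h (X x) \<partial>P) - (\<integral>x. w x * h (Y x) \<partial>Q)\<bar> \<le> 0" by (rule field_le_epsilon[of _ 0, simplified]) 
    then show ?thesis by simp
  qed
  \<comment> \<open>For positive \<open>n\<close>, \<open>h c n\<close> is 1 up to \<open>c\<close>
    and falls linearly to 0 on an interval of length \<open>1 / n\<close>.\<close>
  define h where "h c n y = max 0 (min 1 (1 - real n * (y - c)))" for c y :: real and n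
  have hlim: "(\<lambda>n. h c n y) \<longlonglongrightarrow> indicator {..c} y" for c y
  proof (cases "y \<le> c")
    case True
    then have "h c n y = 1" for n by (simp add: h_def mult_nonneg_nonpos)
    then show ?thesis using True by simp
  next
    case False
    obtain m :: nat where m: "real m * (y - c) > 1" using reals_Archimedean3[of "y - c"] False by auto
    have "h c n y = 0" if "n \<ge> m" for n
    proof -
      have "real n * (y - c) \<ge> real m * (y - c)" using that False by (intro mult_right_mono) auto
      then show ?thesis using m by (simp add: h_def)
    qed
    then have "eventually (\<lambda>n. h c n y = 0) sequentially" using eventually_sequentially by blast
    then show ?thesis using False by (simp add: tendsto_eventually)
  qed
  have hlimint: "(\<lambda>n. \<integral>x. u x * h c n (Z x) \<partial>R) \<longlonglongrightarrow> (\<integral>x. u x * indicator {..c} (Z x) \<partial>R)"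
    if a: "integrable R u" "Z \<in> borel_measurable R" for R :: "'c measure" and u Z c
  proof (rule integral_dominated_convergence[where w="\<lambda>x. \<bar>u x\<bar>"])
    have [measurable]: "u \<in> borel_measurable R" "Z \<in> borel_measurable R" using a by auto
    show "(\<lambda>x. u x * indicat_real {..c} (Z x)) \<in> borel_measurable R" by measurable
    show "(\<lambda>x. u x * h c i (Z x)) \<in> borel_measurable R" for i unfolding h_def by measurable
    show "AE x in R. (\<lambda>i. u x * h c i (Z x)) \<longlonglongrightarrow> u x * indicat_real {..c} (Z x)"
      by (intro AE_I2 tendsto_mult tendsto_const hlim)
    show "AE x in R. norm (u x * h c i (Z x)) \<le> \<bar>u x\<bar>" for i
      by (intro AE_I2) (auto simp: abs_mult h_def intro!: mult_left_le)
  qed (use a in auto)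
  have hc: "continuous_on UNIV (h c n)" for c n unfolding h_def by (intro continuous_intros)
  show ?thesis
  proof (rule integral_indicator_eq_generator[OF v w X Y, of "range (\<lambda>a. {..a})"])
    show "Int_stable (range (\<lambda>a::real. {..a}))"
      by (auto simp: Int_stable_def)
    show "sets borel = sigma_sets (space borel) (range (\<lambda>a::real. {..a}))"
      by (subst borel_eq_atMost) simp
    show "(\<integral>x. v x \<partial>P) = (\<integral>x. w x \<partial>Q)" using moments[of 0] by simp
    fix S :: "real set" assume "S \<in> range (\<lambda>a. {..a})"
    then obtain c where c: "S = {..c}" by auto
    show "(\<integral>x. v x * indicator S (X x) \<partial>P) = (\<integral>x. w x * indicator S (Y x) \<partial>Q)"
      unfolding c by (rule LIMSEQ_unique[OF hlimint[OF v X]]) (use hlimint[OF w Y] cont[OF hc] in simp)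
  qed (use A in auto)
qed

text \<open>The variables exp(-X i) lie in the unit interval, and Laplace arguments in the natural
  numbers give all their joint moments. Coordinates are turned from monomials into indicators one at
  a time, the factors of the other coordinates being absorbed into the density.\<close>

lemma signed_laplace_unique:
  fixes v :: "'a \<Rightarrow> real" and w :: "'b \<Rightarrow> real" and X :: "'a \<Rightarrow> nat \<Rightarrow> real" and Y :: "'b \<Rightarrow> nat \<Rightarrow> real"
  assumes v: "integrable P v" and w: "integrable Q w"
    and X: "\<And>i. (\<lambda>x. X x i) \<in> borel_measurable P" and Y: "\<And>i. (\<lambda>x. Y x i) \<in> borel_measurable Q"
    and X0: "\<And>x i. x \<in> space P \<Longrightarrow> X x i \<ge> 0" and Y0: "\<And>x i. x \<in> space Q \<Longrightarrow> Y x i \<ge> 0"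
    and laplace: "\<And>n s. \<lbrakk>\<And>i. s i \<ge> 0; \<And>i. i \<ge> n \<Longrightarrow> s i = 0\<rbrakk> \<Longrightarrow>
       (\<integral>x. v x * exp (- (\<Sum>i<n. s i * X x i)) \<partial>P) = (\<integral>x. w x * exp (- (\<Sum>i<n. s i * Y x i)) \<partial>Q)"
    and A: "A \<in> sets (PiM UNIV (\<lambda>_. borel))"
  shows "(\<integral>x. v x * indicator A (X x) \<partial>P) = (\<integral>x. w x * indicator A (Y x) \<partial>Q)"
proof -
  note X[measurable] Y[measurable]
  have vm[measurable]: "v \<in> borel_measurable P" "w \<in> borel_measurable Q" using v w by auto
  \<comment> \<open>Indicators in the first \<open>j\<close> coordinates, monomials in the rest. The
    exponents \<open>m\<close> stay general so that in the induction step the exponent of coordinate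
    \<open>j\<close> can run through all natural numbers.\<close>
  have mixed: "(\<integral>x. v x * (\<Prod>i<j. indicator (B i) (exp (- X x i))) * (\<Prod>i\<in>{j..<n}. exp (- X x i) ^ m i) \<partial>P)
      = (\<integral>x. w x * (\<Prod>i<j. indicator (B i) (exp (- Y x i))) * (\<Prod>i\<in>{j..<n}. exp (- Y x i) ^ m i) \<partial>Q)"
    if "j \<le> n" and B: "\<And>i. B i \<in> sets borel" for j n m and B :: "nat \<Rightarrow> real set"
    using that(1)
  proof (induction j arbitrary: m)
    case 0
    have "exp (- (\<Sum>i<n. real (if i < n then m i else 0) * y i)) = (\<Prod>i\<in>{0..<n}. exp (- y i) ^ m i)" for y
      by (simp add: exp_sum sum_negf[symmetric] exp_of_nat_mult[symmetric] atLeast0LessThan)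
    then show ?case using laplace[of "\<lambda>i. if i < n then m i else 0" n] by simp
  next
    case (Suc j)
    define q where "q z = (\<Prod>i<j. indicator (B i) (exp (- z i))) * (\<Prod>i\<in>{Suc j..<n}. exp (- z i) ^ m i)"
      for z :: "nat \<Rightarrow> real"
    have pint: "integrable R (\<lambda>x. u x * q (Z x))" if u: "integrable R u" and Z: "\<And>i. (\<lambda>x. Z x i) \<in> borel_measurable R" 
       and Z0: "\<And>x i. x \<in> space R \<Longrightarrow> Z x i \<ge> 0" for u :: "'c \<Rightarrow> real" and R Z
    proof (rule Bochner_Integration.integrable_bound[OF u])
      note Z[measurable] B[measurable]
      have [measurable]: "u \<in> borel_measurable R" using u by auto
      show "(\<lambda>x. u x * q (Z x)) \<in> borel_measurable R" unfolding q_def by measurable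
      show "AE x in R. norm ((u x * q (Z x))) \<le> norm (u x)"
      proof (rule AE_I2)
        fix x assume "x \<in> space R"
        then have "(\<Prod>i<j. indicator (B i) (exp (- Z x i))) * (\<Prod>i\<in>{Suc j..<n}. exp (- Z x i) ^ m i) \<le> (1::real)"
          using Z0 by (intro mult_le_one prod_le_1 prod_nonneg) (auto intro: power_le_one simp: indicator_def)
        moreover have "(\<Prod>i<j. indicator (B i) (exp (- Z x i))) * (\<Prod>i\<in>{Suc j..<n}. exp (- Z x i) ^ m i) \<ge> (0::real)"
          by (intro mult_nonneg_nonneg prod_nonneg) auto
        ultimately show "norm ((u x * q (Z x))) \<le> norm (u x)" 
          by (auto simp: q_def abs_mult mult.assoc intro!: mult_left_le)
      qed
    qed
    have eqn: "u x * (\<Prod>i<j. indicator (B i) (exp (- Z x i))) * (\<Prod>i\<in>{j..<n}. exp (- Z x i) ^ (m(j := k)) i)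
       = (u x * q (Z x)) * exp (- Z x j) ^ k" for u :: "'c \<Rightarrow> real" and Z x k
    proof -
      have "{j..<n} = insert j {Suc j..<n}" using Suc.prems by auto
      moreover have "(\<Prod>i\<in>{Suc j..<n}. exp (- Z x i) ^ (m(j := k)) i) = (\<Prod>i\<in>{Suc j..<n}. exp (- Z x i) ^ m i)"
        by (intro prod.cong) auto
      ultimately show ?thesis by (simp add: q_def)
    qed
    have "(\<integral>x. v x * q (X x) * indicator (B j) (exp (- X x j)) \<partial>P) = (\<integral>x. w x * q (Y x) * indicator (B j) (exp (- Y x j)) \<partial>Q)"
    proof (rule integral_indicator_eq_of_moments[OF pint[OF v X X0] pint[OF w Y Y0]])
      fix k
      have "j \<le> n" using Suc.prems by simp
      from Suc.IH[OF this, of "m(j := k)"] 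
      show "(\<integral>x. v x * q (X x) * exp (- X x j) ^ k \<partial>P) = (\<integral>x. w x * q (Y x) * exp (- Y x j) ^ k \<partial>Q)"
        unfolding eqn .
    qed (use X0 Y0 B in auto)
    then show ?case by (simp add: q_def mult_ac)
  qed
  have total: "(\<integral>x. v x \<partial>P) = (\<integral>x. w x \<partial>Q)" using laplace[of "\<lambda>_. 0" 0] by simp
  have gen: "sets (PiM UNIV (\<lambda>_. borel)) = sigma_sets (space (PiM UNIV (\<lambda>_::nat. borel :: real measure))) (prod_algebra UNIV (\<lambda>_. borel))"
    by (simp add: sets_PiM space_PiM)
  show ?thesis
  proof (rule integral_indicator_eq_generator[OF v w _ _ gen Int_stable_prod_algebra _ total _ A])
    show "X \<in> measurable P (PiM UNIV (\<lambda>_. borel))" "Y \<in> measurable Q (PiM UNIV (\<lambda>_. borel))"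
      by (auto intro!: measurable_PiM_single' simp: space_PiM)
    show "prod_algebra UNIV (\<lambda>_. borel) \<subseteq> Pow (space (PiM UNIV (\<lambda>_::nat. borel :: real measure)))"
      using prod_algebra_sets_into_space by (simp add: space_PiM)
    fix S assume "S \<in> prod_algebra UNIV (\<lambda>_::nat. borel :: real measure)"
    then obtain J E where S: "S = prod_emb UNIV (\<lambda>_. borel) J (Pi\<^sub>E J E)" "finite J" "\<And>i. i \<in> J \<Longrightarrow> E i \<in> sets (borel :: real measure)"
      by (rule prod_algebraE) auto
    obtain n where n: "J \<subseteq> {..<n}" using S(2) finite_nat_bounded by blast
    \<comment> \<open>The image of \<open>E i\<close> under x \<mapsto> exp(-x), written with
      \<open>ln\<close> so that it is visibly Borel; coordinates outside \<open>J\<close> are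
      unrestricted.\<close>
    define B where "B i = (if i \<in> J then {y. y > 0 \<and> - ln y \<in> E i} else UNIV)" for i
    have Bm: "B i \<in> sets borel" for i
    proof -
      have "{y::real. y > 0 \<and> - ln y \<in> E i} \<in> sets borel" if "i \<in> J"
      proof -
        have [measurable]: "E i \<in> sets borel" using S(3)[OF that] .
        show ?thesis by measurable
      qed
      then show ?thesis by (auto simp: B_def)
    qed
    have ind: "indicator S y = (\<Prod>i<n. indicator (B i) (exp (- y i)) :: real)" for y
    proof -
      have "y \<in> S \<longleftrightarrow> (\<forall>i<n. exp (- y i) \<in> B i)"
        using n by (auto simp: S(1) prod_emb_def PiE_iff B_def restrict_def extensional_def)
      moreover have "(\<Prod>i<n. indicator (B i) (exp (- y i)) :: real) = (if \<forall>i<n. exp (- y i) \<in> B i then 1 else 0)"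
        by (auto simp: indicator_def)
      ultimately show ?thesis by (simp add: indicator_def)
    qed
    show "(\<integral>x. v x * indicator S (X x) \<partial>P) = (\<integral>x. w x * indicator S (Y x) \<partial>Q)"
      using mixed[of n n B "\<lambda>_. 0", OF order_refl Bm] by (simp add: ind)
  qed
qed

section \<open>Laplace transforms of signed measures carried by an event\<close>

abbreviation seq_borel :: "(nat \<Rightarrow> real) measure" where
  "seq_borel \<equiv> PiM UNIV (\<lambda>_. borel)"

text \<open>Encodes that \<open>\<Phi>\<close> is the Laplace transform of a signed measure on sequences which has total
  variation at most \<open>C\<close> and is carried by \<open>G\<close>: the signed measure is the image under the second
  projection of \<open>Q\<close> with density \<open>C\<close> times the first projection. The argument \<open>n\<close> bounds the support of \<open>s\<close>.\<close>
definition laplace_rep :: "((nat \<Rightarrow> real) \<Rightarrow> bool) \<Rightarrow> (nat \<Rightarrow> (nat \<Rightarrow> real) \<Rightarrow> real) \<Rightarrow> real \<Rightarrow> bool" where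
  "laplace_rep G \<Phi> C \<longleftrightarrow> 0 \<le> C \<and> (\<exists>Q. prob_space Q \<and> sets Q = sets (borel \<Otimes>\<^sub>M seq_borel) \<and>
     (AE y in Q. \<bar>fst y\<bar> \<le> 1 \<and> (\<forall>i. 0 \<le> snd y i) \<and> G (snd y)) \<and>
     (\<forall>n s. (\<forall>i. 0 \<le> s i) \<longrightarrow> (\<forall>i\<ge>n. s i = 0) \<longrightarrow>
        \<Phi> n s = C * (\<integral>y. fst y * exp (- (\<Sum>i<n. s i * snd y i)) \<partial>Q)))"

lemma laplace_repI:
  assumes "0 \<le> C" "prob_space Q" "sets Q = sets (borel \<Otimes>\<^sub>M seq_borel)"
    "AE y in Q. \<bar>fst y\<bar> \<le> 1 \<and> (\<forall>i. 0 \<le> snd y i) \<and> G (snd y)"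
    "\<And>n s. \<lbrakk>\<And>i. 0 \<le> s i; \<And>i. i \<ge> n \<Longrightarrow> s i = 0\<rbrakk> \<Longrightarrow>
       \<Phi> n s = C * (\<integral>y. fst y * exp (- (\<Sum>i<n. s i * snd y i)) \<partial>Q)"
  shows "laplace_rep G \<Phi> C"
  using assms unfolding laplace_rep_def by blast

lemma laplace_repE:
  assumes "laplace_rep G \<Phi> C"
  obtains Q where "0 \<le> C" "prob_space Q" "sets Q = sets (borel \<Otimes>\<^sub>M seq_borel)"
    "AE y in Q. \<bar>fst y\<bar> \<le> 1 \<and> (\<forall>i. 0 \<le> snd y i) \<and> G (snd y)"
    "\<And>n s. \<lbrakk>\<And>i. 0 \<le> s i; \<And>i. i \<ge> n \<Longrightarrow> s i = 0\<rbrakk> \<Longrightarrow>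
       \<Phi> n s = C * (\<integral>y. fst y * exp (- (\<Sum>i<n. s i * snd y i)) \<partial>Q)"
  using assms unfolding laplace_rep_def by blast

lemma laplace_rep_cong:
  assumes "laplace_rep G \<Phi> C"
    and "\<And>n s. \<lbrakk>\<And>i. 0 \<le> s i; \<And>i. i \<ge> n \<Longrightarrow> s i = 0\<rbrakk> \<Longrightarrow> \<Phi> n s = \<Psi> n s"
  shows "laplace_rep G \<Psi> C"
proof (rule laplace_repE[OF assms(1)])
  fix Q assume Q: "0 \<le> C" "prob_space Q" "sets Q = sets (borel \<Otimes>\<^sub>M seq_borel)"
    "AE y in Q. \<bar>fst y\<bar> \<le> 1 \<and> (\<forall>i. 0 \<le> snd y i) \<and> G (snd y)"
    and \<Phi>: "\<And>n s. \<lbrakk>\<And>i. 0 \<le> s i; \<And>i. i \<ge> n \<Longrightarrow> s i = 0\<rbrakk> \<Longrightarrow>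
       \<Phi> n s = C * (\<integral>y. fst y * exp (- (\<Sum>i<n. s i * snd y i)) \<partial>Q)"
  show ?thesis
    by (rule laplace_repI[OF Q]) (simp only: assms(2)[symmetric] \<Phi>)
qed

text \<open>The scalar and the slack between the two bounds both go into the first projection, which
  has to stay in [-1, 1].\<close>

lemma laplace_rep_scale:
  assumes "laplace_rep G \<Phi> C" and C': "\<bar>c\<bar> * C \<le> C'"
    and G[measurable]: "Measurable.pred seq_borel G"
  shows "laplace_rep G (\<lambda>n s. c * \<Phi> n s) C'"
proof -
  from assms(1) obtain Q where C: "0 \<le> C" and Q: "prob_space Q" and sQ[measurable_cong]: "sets Q = sets (borel \<Otimes>\<^sub>M seq_borel)"
    and ae: "AE y in Q. \<bar>fst y\<bar> \<le> 1 \<and> (\<forall>i. 0 \<le> snd y i) \<and> G (snd y)"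
    and \<Phi>: "\<And>n s. \<lbrakk>\<And>i. 0 \<le> s i; \<And>i. i \<ge> n \<Longrightarrow> s i = 0\<rbrakk> \<Longrightarrow>
       \<Phi> n s = C * (\<integral>y. fst y * exp (- (\<Sum>i<n. s i * snd y i)) \<partial>Q)"
    by (rule laplace_repE) blast
  \<comment> \<open>For \<open>C' = 0\<close> the division yields 0, and then
    \<open>c * C = 0\<close> as well, so \<open>C' * d = c * C\<close> holds in every case.\<close>
  define d where "d = c * C / C'"
  have C'0: "0 \<le> C'" using C C' by (smt (verit) mult_nonneg_nonneg)
  have "c * C = 0" if "C' = 0"
    using C C' that by (metis abs_le_zero_iff abs_mult abs_of_nonneg)
  then have d: "\<bar>d\<bar> \<le> 1" "C' * d = c * C"
    using C C' C'0 by (auto simp: d_def abs_mult divide_le_eq_1)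
  define T where "T y = (d * fst y, snd y)" for y :: "real \<times> (nat \<Rightarrow> real)"
  have T[measurable]: "T \<in> measurable Q (borel \<Otimes>\<^sub>M seq_borel)" unfolding T_def by measurable
  show ?thesis
  proof (rule laplace_repI[where Q="distr Q (borel \<Otimes>\<^sub>M seq_borel) T"])
    show "prob_space (distr Q (borel \<Otimes>\<^sub>M seq_borel) T)"
      by (rule prob_space.prob_space_distr[OF Q T])
    have "AE y in Q. \<bar>fst (T y)\<bar> \<le> 1 \<and> (\<forall>i. 0 \<le> snd (T y) i) \<and> G (snd (T y))"
      using ae by (rule AE_mp) (use d(1) in \<open>auto intro!: AE_I2 mult_le_one simp: T_def abs_mult\<close>)
    then show "AE y in distr Q (borel \<Otimes>\<^sub>M seq_borel) T. \<bar>fst y\<bar> \<le> 1 \<and> (\<forall>i. 0 \<le> snd y i) \<and> G (snd y)"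
      by (subst AE_distr_iff) auto
  next
    fix n :: nat and s :: "nat \<Rightarrow> real" assume s: "\<And>i. 0 \<le> s i" "\<And>i. i \<ge> n \<Longrightarrow> s i = 0"
    have "(\<integral>y. fst y * exp (- (\<Sum>i<n. s i * snd y i)) \<partial>distr Q (borel \<Otimes>\<^sub>M seq_borel) T)
      = (\<integral>y. d * (fst y * exp (- (\<Sum>i<n. s i * snd y i))) \<partial>Q)"
      by (subst integral_distr[OF T]) (auto simp: T_def mult.assoc)
    then have "(\<integral>y. fst y * exp (- (\<Sum>i<n. s i * snd y i)) \<partial>distr Q (borel \<Otimes>\<^sub>M seq_borel) T)
      = d * (\<integral>y. fst y * exp (- (\<Sum>i<n. s i * snd y i)) \<partial>Q)"
      by (simp only: integral_mult_right_zero)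
    then show "c * \<Phi> n s = C' * (\<integral>y. fst y * exp (- (\<Sum>i<n. s i * snd y i)) \<partial>distr Q (borel \<Otimes>\<^sub>M seq_borel) T)"
      by (simp only: \<Phi>[of s n, OF s] mult.assoc[symmetric] d(2))
  qed (use C'0 in auto)
qed

text \<open>The components are mixed with probabilities \<open>C j / D\<close>, where
  \<open>D\<close> is the sum of the bounds; the factor \<open>D\<close> in front undoes the
  normalisation.\<close>

lemma laplace_rep_suminf:
  fixes \<Phi> :: "nat \<Rightarrow> nat \<Rightarrow> (nat \<Rightarrow> real) \<Rightarrow> real"
  assumes rep: "\<And>j. laplace_rep G (\<Phi> j) (C j)" and C: "summable C"
    and G[measurable]: "Measurable.pred seq_borel G"
  shows "laplace_rep G (\<lambda>n s. \<Sum>j. \<Phi> j n s) (\<Sum>j. C j)"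
proof -
  have C0: "0 \<le> C j" for j using rep[of j] by (rule laplace_repE)
  define D where "D = (\<Sum>j. C j)"
  have D0: "D \<ge> 0" unfolding D_def using C C0 by (rule suminf_nonneg)
  show ?thesis
  proof (cases "D = 0")
    \<comment> \<open>If all bounds vanish there is no mixing law, but then every
      \<open>\<Phi> j\<close> is zero on admissible arguments.\<close>
    case True
    then have C00: "C j = 0" for j using C C0 suminf_eq_zero_iff[of C] unfolding D_def by auto
    have z: "\<Phi> j n s = 0" if "\<And>i. 0 \<le> s i" "\<And>i. i \<ge> n \<Longrightarrow> s i = 0" for j n s
    proof -
      have "\<exists>I. \<Phi> j n s = C j * I" using rep[of j] that unfolding laplace_rep_def by blast
      then show ?thesis by (auto simp: C00)
    qed
    have "laplace_rep G (\<lambda>n s. \<Sum>j. \<Phi> j n s) 0"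
    proof (rule laplace_rep_cong)
      show "laplace_rep G (\<lambda>n s. 0 * \<Phi> 0 n s) 0" by (rule laplace_rep_scale[OF rep]) (use G in auto)
    qed (simp add: z)
    then show ?thesis using True D_def by simp
  next
    case False
    with D0 have D: "D > 0" by simp
    define R where "R j Q \<longleftrightarrow> prob_space Q \<and> sets Q = sets (borel \<Otimes>\<^sub>M seq_borel) \<and>
      (AE y in Q. \<bar>fst y\<bar> \<le> 1 \<and> (\<forall>i. 0 \<le> snd y i) \<and> G (snd y)) \<and>
      (\<forall>n s. (\<forall>i. 0 \<le> s i) \<longrightarrow> (\<forall>i\<ge>n. s i = 0) \<longrightarrow>
        \<Phi> j n s = C j * (\<integral>y. fst y * exp (- (\<Sum>i<n. s i * snd y i)) \<partial>Q))" for j Q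
    have "\<forall>j. \<exists>Q. R j Q"
    proof
      fix j show "\<exists>Q. R j Q" using rep[of j] unfolding laplace_rep_def R_def by (rule conjunct2)
    qed
    from choice[OF this] obtain Q where RQ: "\<And>j. R j (Q j)" by blast
    have Q: "\<And>j. prob_space (Q j)" and sQ: "\<And>j. sets (Q j) = sets (borel \<Otimes>\<^sub>M seq_borel)"
      and ae: "\<And>j. AE y in Q j. \<bar>fst y\<bar> \<le> 1 \<and> (\<forall>i. 0 \<le> snd y i) \<and> G (snd y)"
      using RQ unfolding R_def by blast+
    have \<Phi>: "\<Phi> j n s = C j * (\<integral>y. fst y * exp (- (\<Sum>i<n. s i * snd y i)) \<partial>Q j)"
      if "\<And>i. 0 \<le> s i" "\<And>i. i \<ge> n \<Longrightarrow> s i = 0" for j n s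
      using RQ[of j] that unfolding R_def by blast
    define p where "p = density (count_space UNIV) (\<lambda>j. ennreal (C j / D))"
    have sums: "(\<lambda>j. C j / D) sums 1"
      using sums_divide[OF summable_sums[OF C], of D] D by (simp add: D_def[symmetric])
    have p: "prob_space p"
      using sums C0 D0 unfolding p_def
      by (intro prob_spaceI) (simp add: emeasure_density nn_integral_count_space_nat suminf_ennreal2 sums_iff)
    have Qm: "Q \<in> measurable p (subprob_algebra (borel \<Otimes>\<^sub>M seq_borel))"
      using Q sQ unfolding p_def by (auto simp: space_subprob_algebra prob_space_imp_subprob_space)
    have nonempty: "space p \<noteq> {}" by (simp add: p_def)
    have sets_bind: "sets (p \<bind> Q) = sets (borel \<Otimes>\<^sub>M seq_borel)"
      by (rule sets_bind[OF sQ nonempty])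
    show ?thesis unfolding D_def[symmetric]
    proof (rule laplace_repI[where Q="p \<bind> Q"])
      show "prob_space (p \<bind> Q)"
        by (rule prob_space.prob_space_bind[OF p _ Qm]) (use Q in auto)
      show "AE y in p \<bind> Q. \<bar>fst y\<bar> \<le> 1 \<and> (\<forall>i. 0 \<le> snd y i) \<and> G (snd y)"
        by (subst AE_bind[OF Qm]) (use ae in auto)
    next
      fix n :: nat and s :: "nat \<Rightarrow> real" assume s: "\<And>i. 0 \<le> s i" "\<And>i. i \<ge> n \<Longrightarrow> s i = 0"
      \<comment> \<open>The integrand is bounded only almost everywhere under the components, while
        \<open>integral_bind\<close> is applied with a bound that holds everywhere; the truncation
        changes it on null sets only.\<close>
      define h where "h y = max (-1) (min 1 (fst y * exp (- (\<Sum>i<n. s i * snd y i))))" for y :: "real \<times> (nat \<Rightarrow> real)"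
      have hm[measurable]: "h \<in> borel_measurable (borel \<Otimes>\<^sub>M seq_borel)" unfolding h_def by measurable
      have ae': "AE y in R. fst y * exp (- (\<Sum>i<n. s i * snd y i)) = h y"
        if "AE y in R. \<bar>fst y\<bar> \<le> 1 \<and> (\<forall>i. 0 \<le> snd y i) \<and> G (snd y)" for R
        using that
      proof (rule AE_mp, intro AE_I2 impI)
        fix y :: "real \<times> (nat \<Rightarrow> real)" assume y: "\<bar>fst y\<bar> \<le> 1 \<and> (\<forall>i. 0 \<le> snd y i) \<and> G (snd y)"
        then have "\<bar>fst y * exp (- (\<Sum>i<n. s i * snd y i))\<bar> \<le> 1"
          using s by (auto simp: abs_mult intro!: mult_le_one sum_nonneg)
        then show "fst y * exp (- (\<Sum>i<n. s i * snd y i)) = h y" unfolding h_def by linarith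
      qed
      have eqh: "(\<integral>y. fst y * exp (- (\<Sum>i<n. s i * snd y i)) \<partial>R) = (\<integral>y. h y \<partial>R)"
        if "AE y in R. \<bar>fst y\<bar> \<le> 1 \<and> (\<forall>i. 0 \<le> snd y i) \<and> G (snd y)" and [measurable_cong]: "sets R = sets (borel \<Otimes>\<^sub>M seq_borel)" for R
        by (intro integral_cong_AE ae' that) measurable
      have h1: "\<bar>h y\<bar> \<le> 1" for y unfolding h_def by linarith
      have bound: "\<bar>\<integral>y. h y \<partial>Q j\<bar> \<le> 1" for j
      proof -
        interpret prob_space "Q j" by (rule Q)
        have [measurable_cong]: "sets (Q j) = sets (borel \<Otimes>\<^sub>M seq_borel)" by (rule sQ)
        have "\<bar>\<integral>y. h y \<partial>Q j\<bar> \<le> (\<integral>y. \<bar>h y\<bar> \<partial>Q j)" by (rule integral_abs_bound)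
        also have "\<dots> \<le> (\<integral>y. 1 \<partial>Q j)"
          by (intro integral_mono integrable_const_bound[where B=1]) (auto simp: h1)
        finally show ?thesis by (simp add: prob_space)
      qed
      have aeb: "AE y in p \<bind> Q. \<bar>fst y\<bar> \<le> 1 \<and> (\<forall>i. 0 \<le> snd y i) \<and> G (snd y)"
        by (subst AE_bind[OF Qm]) (use ae in auto)
      have "(\<integral>y. fst y * exp (- (\<Sum>i<n. s i * snd y i)) \<partial>(p \<bind> Q)) = (\<integral>y. h y \<partial>(p \<bind> Q))"
        by (rule eqh[OF aeb sets_bind])
      also have "\<dots> = (\<integral>j. (\<integral>y. h y \<partial>Q j) \<partial>p)"
        using Q p by (intro integral_bind[OF hm _ Qm, where B=1 and B'=1]) (auto simp: h1 prob_space.emeasure_space_1 prob_space.finite_measure)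
      also have "\<dots> = (\<integral>j. (C j / D) * (\<integral>y. h y \<partial>Q j) \<partial>count_space UNIV)"
        unfolding p_def using C0 D by (subst integral_density) auto
      also have "\<dots> = (\<Sum>j. (C j / D) * (\<integral>y. h y \<partial>Q j))"
      proof (rule integral_count_space_nat)
        have "summable (\<lambda>j. norm ((C j / D) * (\<integral>y. h y \<partial>Q j)))"
        proof (rule summable_comparison_test'[where N=0])
          show "summable (\<lambda>j. C j / D)" using sums by (simp add: sums_iff)
          fix j show "norm (norm ((C j / D) * (\<integral>y. h y \<partial>Q j))) \<le> C j / D"
            using bound[of j] C0[of j] D by (auto simp: abs_mult divide_simps intro!: mult_left_le)
        qed
        then show "integrable (count_space UNIV) (\<lambda>j. (C j / D) * (\<integral>y. h y \<partial>Q j))"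
          by (simp add: integrable_count_space_nat_iff)
      qed
      also have "\<dots> = (\<Sum>j. \<Phi> j n s / D)"
        using \<Phi>[of s n, OF s] eqh[OF ae sQ] by simp
      finally have *: "(\<integral>y. fst y * exp (- (\<Sum>i<n. s i * snd y i)) \<partial>(p \<bind> Q)) = (\<Sum>j. \<Phi> j n s / D)" .
      have "summable (\<lambda>j. \<Phi> j n s)"
      proof (rule summable_comparison_test'[OF C, where N=0])
        fix j show "norm (\<Phi> j n s) \<le> C j"
          using bound[of j] C0[of j] \<Phi>[of s n j, OF s] eqh[OF ae sQ, of j] by (auto simp: abs_mult intro!: mult_left_le)
      qed
      then show "(\<Sum>j. \<Phi> j n s) = D * (\<integral>y. fst y * exp (- (\<Sum>i<n. s i * snd y i)) \<partial>(p \<bind> Q))"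
        unfolding * using D by (subst suminf_mult[symmetric]) (auto intro: summable_divide)
    qed (use D0 sets_bind in auto)
  qed
qed

lemma laplace_rep_add:
  assumes \<Phi>: "laplace_rep G \<Phi> C" and \<Psi>: "laplace_rep G \<Psi> D"
    and G: "Measurable.pred seq_borel G"
  shows "laplace_rep G (\<lambda>n s. \<Phi> n s + \<Psi> n s) (C + D)"
proof -
  define F where "F j = (if j = 0 then \<Phi> else if j = 1 then \<Psi> else (\<lambda>_ _. 0))" for j :: nat
  define E where "E j = (if j = 0 then C else if j = 1 then D else 0)" for j :: nat
  have "laplace_rep G (F j) (E j)" for j
    using assms laplace_rep_scale[OF \<Phi>, of 0 0] by (auto simp: F_def E_def)
  moreover have "summable E" by (rule summable_finite[of "{0,1}"]) (auto simp: E_def)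
  ultimately have "laplace_rep G (\<lambda>n s. \<Sum>j. F j n s) (\<Sum>j. E j)" by (rule laplace_rep_suminf[OF _ _ G])
  moreover have "(\<Sum>j. F j n s) = \<Phi> n s + \<Psi> n s" for n s
    by (subst suminf_finite[of "{0,1}"]) (auto simp: F_def)
  moreover have "(\<Sum>j. E j) = C + D"
    by (subst suminf_finite[of "{0,1}"]) (auto simp: E_def)
  ultimately show ?thesis by simp
qed

text \<open>\<open>1 / (1 + l * s i)\<close> is the Laplace transform of an exponential variable
  with mean \<open>l\<close>. Adding an independent one to coordinate \<open>i\<close> multiplies
  the transform by this factor, and by \<open>inv\<close> the measure is still carried by
  \<open>G\<close>.\<close>

lemma laplace_rep_mult_exponential:
  fixes l :: real
  assumes rep: "laplace_rep G \<Phi> C" and l: "l > 0"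
    and G[measurable]: "Measurable.pred seq_borel G"
    and inv: "\<And>x e. G x \<Longrightarrow> G (x(i := x i + e))"
  shows "laplace_rep G (\<lambda>n s. 1 / (1 + l * s i) * \<Phi> n s) C"
proof -
  from rep obtain Q where C: "0 \<le> C" and Q: "prob_space Q" and sQ[measurable_cong]: "sets Q = sets (borel \<Otimes>\<^sub>M seq_borel)"
    and ae: "AE y in Q. \<bar>fst y\<bar> \<le> 1 \<and> (\<forall>i. 0 \<le> snd y i) \<and> G (snd y)"
    and \<Phi>: "\<And>n s. \<lbrakk>\<And>i. 0 \<le> s i; \<And>i. i \<ge> n \<Longrightarrow> s i = 0\<rbrakk> \<Longrightarrow>
       \<Phi> n s = C * (\<integral>y. fst y * exp (- (\<Sum>i<n. s i * snd y i)) \<partial>Q)"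
    by (rule laplace_repE) blast
  define E where "E = density lborel (exponential_density (1 / l))"
  have pE: "prob_space E" unfolding E_def using l by (intro prob_space_exponential_density) auto
  have sE[measurable_cong]: "sets E = sets borel" by (simp add: E_def)
  interpret Q: prob_space Q by (rule Q)
  interpret E: prob_space E by (rule pE)
  interpret QE: pair_prob_space Q E ..
  define T where "T z = (fst (fst z), (snd (fst z))(i := snd (fst z) i + snd z))" for z :: "(real \<times> (nat \<Rightarrow> real)) \<times> real"
  have T[measurable]: "T \<in> measurable (Q \<Otimes>\<^sub>M E) (borel \<Otimes>\<^sub>M seq_borel)"
    unfolding T_def
    by (intro measurable_Pair measurable_PiM_single') (auto simp: space_PiM fun_upd_def intro!: measurable_If)
  have E0: "AE e in E. e \<ge> 0"
    unfolding E_def using l by (subst AE_density) (auto simp: exponential_density_def split: if_splits intro!: AE_I2)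
  have lapE: "(\<integral>e. exp (- (t * e)) \<partial>E) = 1 / (1 + l * t)" if t: "t \<ge> 0" for t
  proof -
    have pos: "1 / l + t > 0" using l t by (simp add: add_pos_nonneg)
    interpret X: prob_space "density lborel (exponential_density (1 / l + t))"
      by (rule prob_space_exponential_density[OF pos])
    have "(\<integral>e. exp (- (t * e)) \<partial>E) = (\<integral>e. exponential_density (1 / l) e * exp (- (t * e)) \<partial>lborel)"
      unfolding E_def using l by (subst integral_density) (auto simp: exponential_density_nonneg)
    \<comment> \<open>Exponential tilting: up to the constant, the product is the exponential
      density of rate \<open>1 / l + t\<close>.\<close>
    also have "\<dots> = (\<integral>e. 1 / (1 + l * t) * exponential_density (1 / l + t) e \<partial>lborel)"
    proof (intro Bochner_Integration.integral_cong refl)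
      fix e :: real
      have "exp (- e / l) * exp (- (t * e)) = exp (- e * (1 / l + t))"
        by (simp add: exp_add[symmetric] algebra_simps)
      moreover have "1 + l * t > 0" using l t by (simp add: add_pos_nonneg)
      ultimately show "exponential_density (1 / l) e * exp (- (t * e)) = 1 / (1 + l * t) * exponential_density (1 / l + t) e"
        using l by (auto simp: exponential_density_def field_simps)
    qed
    also have "\<dots> = 1 / (1 + l * t) * (\<integral>e. 1 \<partial>density lborel (exponential_density (1 / l + t)))"
      using pos by (subst integral_density) (auto simp: exponential_density_nonneg)
    finally show ?thesis using X.prob_space by simp
  qed
  have aeT: "AE z in Q \<Otimes>\<^sub>M E. \<bar>fst (T z)\<bar> \<le> 1 \<and> (\<forall>i. 0 \<le> snd (T z) i) \<and> G (snd (T z))"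
  proof (rule QE.AE_pair_measure)
    show "{z \<in> space (Q \<Otimes>\<^sub>M E). \<bar>fst (T z)\<bar> \<le> 1 \<and> (\<forall>i. 0 \<le> snd (T z) i) \<and> G (snd (T z))} \<in> sets (Q \<Otimes>\<^sub>M E)"
      by measurable
    show "AE y in Q. AE e in E. \<bar>fst (T (y, e))\<bar> \<le> 1 \<and> (\<forall>i. 0 \<le> snd (T (y, e)) i) \<and> G (snd (T (y, e)))"
    proof (rule AE_mp[OF ae], rule AE_I2, rule impI)
      fix y :: "real \<times> (nat \<Rightarrow> real)" assume y: "\<bar>fst y\<bar> \<le> 1 \<and> (\<forall>i. 0 \<le> snd y i) \<and> G (snd y)"
      show "AE e in E. \<bar>fst (T (y, e))\<bar> \<le> 1 \<and> (\<forall>i. 0 \<le> snd (T (y, e)) i) \<and> G (snd (T (y, e)))"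
        using E0 by (rule AE_mp) (use y inv in \<open>auto simp: T_def intro!: AE_I2\<close>)
    qed
  qed
  show ?thesis
  proof (rule laplace_repI[where Q="distr (Q \<Otimes>\<^sub>M E) (borel \<Otimes>\<^sub>M seq_borel) T"])
    show "prob_space (distr (Q \<Otimes>\<^sub>M E) (borel \<Otimes>\<^sub>M seq_borel) T)"
      by (rule QE.prob_space_distr[OF T])
    show "AE y in distr (Q \<Otimes>\<^sub>M E) (borel \<Otimes>\<^sub>M seq_borel) T. \<bar>fst y\<bar> \<le> 1 \<and> (\<forall>i. 0 \<le> snd y i) \<and> G (snd y)"
      using aeT by (subst AE_distr_iff) auto
  next
    fix n :: nat and s :: "nat \<Rightarrow> real" assume s: "\<And>i. 0 \<le> s i" "\<And>i. i \<ge> n \<Longrightarrow> s i = 0"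
    let ?f = "\<lambda>y. fst y * exp (- (\<Sum>i<n. s i * snd y i))"
    have fT: "?f (T (y, e)) = ?f y * exp (- (s i * e))" for y :: "real \<times> (nat \<Rightarrow> real)" and e
    proof (cases "i < n")
      case True
      have "(\<Sum>j<n. s j * ((snd y)(i := snd y i + e)) j) = (\<Sum>j<n. s j * snd y j + (if j = i then s i * e else 0))"
        by (intro sum.cong) (auto simp: distrib_left)
      also have "\<dots> = (\<Sum>j<n. s j * snd y j) + s i * e"
        using True by (simp add: sum.distrib)
      finally show ?thesis by (simp add: T_def exp_add[symmetric] mult.assoc)
    next
      \<comment> \<open>Beyond the support bound \<open>s i\<close> is 0, so a variable added there
        is not seen and its factor is 1.\<close>
      case False
      then have "(\<Sum>j<n. s j * ((snd y)(i := snd y i + e)) j) = (\<Sum>j<n. s j * snd y j)"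
        by (intro sum.cong) auto
      then show ?thesis using False s by (simp add: T_def)
    qed
    have "integrable (Q \<Otimes>\<^sub>M E) (\<lambda>z. ?f (T z))"
    proof (rule QE.integrable_const_bound[where B=1])
      show "AE z in Q \<Otimes>\<^sub>M E. norm (?f (T z)) \<le> 1"
        using aeT by (rule AE_mp) (use s in \<open>auto intro!: AE_I2 mult_le_one sum_nonneg simp: abs_mult\<close>)
    qed measurable
    then have int: "integrable (Q \<Otimes>\<^sub>M E) (\<lambda>(y, e). ?f (T (y, e)))" by (simp add: case_prod_beta')
    have "(\<integral>z. ?f z \<partial>distr (Q \<Otimes>\<^sub>M E) (borel \<Otimes>\<^sub>M seq_borel) T) = (\<integral>z. (\<lambda>(y, e). ?f (T (y, e))) z \<partial>(Q \<Otimes>\<^sub>M E))"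
      by (subst integral_distr[OF T]) (auto simp: case_prod_beta')
    also have "\<dots> = (\<integral>y. (\<integral>e. ?f (T (y, e)) \<partial>E) \<partial>Q)"
      by (rule QE.integral_fst'[OF int, symmetric, simplified prod.case])
    also have "\<dots> = (\<integral>y. ?f y * (1 / (1 + l * s i)) \<partial>Q)"
      unfolding fT by (simp add: lapE[OF s(1)])
    finally show "1 / (1 + l * s i) * \<Phi> n s = C * (\<integral>z. ?f z \<partial>distr (Q \<Otimes>\<^sub>M E) (borel \<Otimes>\<^sub>M seq_borel) T)"
      using \<Phi>[of s n, OF s] by simp
  qed (use C in auto)
qed

text \<open>Each \<open>1 - 1 / (1 + l i * s i)\<close> is a difference of two multiplications that
  keep the bound, whence the 2. Coordinate 0 carries weight 0 because \<open>inv\<close> says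
  nothing about changing it.\<close>

lemma laplace_rep_mult_sum:
  fixes l w :: "nat \<Rightarrow> real"
  assumes rep: "laplace_rep G \<Phi> C" and l: "\<And>i. i > 0 \<Longrightarrow> l i > 0"
    and G: "Measurable.pred seq_borel G"
    and inv: "\<And>i x e. i > 0 \<Longrightarrow> G x \<Longrightarrow> G (x(i := x i + e))"
    and w: "summable w" "\<And>i. w i \<ge> 0" "w 0 = 0"
  shows "laplace_rep G (\<lambda>n s. (\<Sum>i<n. w i * (1 - 1 / (1 + l i * s i))) * \<Phi> n s) (2 * suminf w * C)"
proof -
  have C: "C \<ge> 0" using rep by (rule laplace_repE)
  have "laplace_rep G (\<lambda>n s. w i * (\<Phi> n s + (-1) * (1 / (1 + l i * s i) * \<Phi> n s))) (w i * (2 * C))" for i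
  proof (cases "i = 0")
    case True
    then show ?thesis using w laplace_rep_scale[OF rep, of 0 0] G by simp
  next
    case False
    then have i: "i > 0" by simp
    have "laplace_rep G (\<lambda>n s. \<Phi> n s + (-1) * (1 / (1 + l i * s i) * \<Phi> n s)) (C + C)"
      by (intro laplace_rep_add laplace_rep_scale[where C=C] laplace_rep_mult_exponential rep l inv i G) auto
    then show ?thesis using w(2)[of i] C G by (intro laplace_rep_scale) (auto simp: mult_left_mono)
  qed
  then have "laplace_rep G (\<lambda>n s. \<Sum>i. w i * (\<Phi> n s + (-1) * (1 / (1 + l i * s i) * \<Phi> n s))) (\<Sum>i. w i * (2 * C))"
    by (rule laplace_rep_suminf[OF _ _ G]) (use w in \<open>auto intro: summable_mult2\<close>)
  moreover have "(\<Sum>i. w i * (2 * C)) = 2 * suminf w * C"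
    using w by (subst suminf_mult2[symmetric]) auto
  ultimately have "laplace_rep G (\<lambda>n s. \<Sum>i. w i * (\<Phi> n s + (-1) * (1 / (1 + l i * s i) * \<Phi> n s))) (2 * suminf w * C)" by simp
  then show ?thesis
  proof (rule laplace_rep_cong)
    fix n :: nat and s :: "nat \<Rightarrow> real" assume s: "\<And>i. i \<ge> n \<Longrightarrow> s i = 0"
    \<comment> \<open>Terms with \<open>i \<ge> n\<close> vanish because \<open>s i = 0\<close>;
      this is how a series that does not depend on \<open>n\<close> represents sums up to
      \<open>n\<close>.\<close>
    have "(\<Sum>i. w i * (\<Phi> n s + (-1) * (1 / (1 + l i * s i) * \<Phi> n s))) = (\<Sum>i<n. w i * (\<Phi> n s + (-1) * (1 / (1 + l i * s i) * \<Phi> n s)))"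
      by (rule suminf_finite) (auto simp: s)
    then show "(\<Sum>i. w i * (\<Phi> n s + (-1) * (1 / (1 + l i * s i) * \<Phi> n s))) = (\<Sum>i<n. w i * (1 - 1 / (1 + l i * s i))) * \<Phi> n s"
      by (simp add: sum_distrib_right sum_distrib_left algebra_simps)
  qed
qed

section \<open>The unperturbed process\<close>

lemma nn_integral_normal_exp_square:
  fixes s c \<mu> :: real
  assumes d: "1 + \<mu>\<^sup>2 * s > 0"
  shows "(\<integral>\<^sup>+x. ennreal (exp (- (s * (\<mu> * x + c)\<^sup>2 / 2))) \<partial>density lborel std_normal_density)
    = ennreal ((1 + \<mu>\<^sup>2 * s) powr (-1/2) * exp (- (c\<^sup>2 * (s / (1 + \<mu>\<^sup>2 * s)) / 2)))"
proof -
  define D where "D = 1 + \<mu>\<^sup>2 * s"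
  have D: "D > 0" using d by (simp add: D_def)
  have sq: "D powr (-1/2) = 1 / sqrt D" using D by (simp add: powr_minus_divide powr_half_sqrt)
  have e: "std_normal_density x * exp (- (s * (\<mu> * x + c)\<^sup>2 / 2)) =
      (D powr (-1/2) * exp (- (c\<^sup>2 * (s / D) / 2))) * normal_density (- (s * \<mu> * c / D)) (1 / sqrt D) x" for x
  proof -
    have sD: "s * \<mu>\<^sup>2 = D - 1" by (simp add: D_def)
    have "D * (x + s * \<mu> * c / D)\<^sup>2 = D * x\<^sup>2 + 2 * s * \<mu> * c * x + (s * \<mu>\<^sup>2) * s * c\<^sup>2 / D"
      using D by (simp add: power2_eq_square field_simps)
    also have "\<dots> = D * x\<^sup>2 + 2 * s * \<mu> * c * x + s * c\<^sup>2 - c\<^sup>2 * (s / D)"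
      unfolding sD using D by (simp add: field_simps)
    also have "\<dots> = x\<^sup>2 + s * (\<mu> * x + c)\<^sup>2 - c\<^sup>2 * (s / D)"
      by (simp add: D_def power2_eq_square algebra_simps)
    finally have q: "x\<^sup>2 + s * (\<mu> * x + c)\<^sup>2 = D * (x + s * \<mu> * c / D)\<^sup>2 + c\<^sup>2 * (s / D)" by simp
    have "exp (- x\<^sup>2 / 2) * exp (- (s * (\<mu> * x + c)\<^sup>2 / 2)) = exp (- (x\<^sup>2 + s * (\<mu> * x + c)\<^sup>2) / 2)"
      by (simp add: exp_add[symmetric] field_simps)
    also have "\<dots> = exp (- (c\<^sup>2 * (s / D) / 2)) * exp (- (D * (x + s * \<mu> * c / D)\<^sup>2) / 2)"
      unfolding q by (simp add: exp_add[symmetric] field_simps)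
    finally have q2: "exp (- x\<^sup>2 / 2) * exp (- (s * (\<mu> * x + c)\<^sup>2 / 2)) = \<dots>" .
    have n: "normal_density (- (s * \<mu> * c / D)) (1 / sqrt D) x = sqrt D / sqrt (2 * pi) * exp (- (D * (x + s * \<mu> * c / D)\<^sup>2) / 2)"
      using D by (simp add: normal_density_def power_divide real_sqrt_divide field_simps)
    have "std_normal_density x * exp (- (s * (\<mu> * x + c)\<^sup>2 / 2)) = 1 / sqrt (2 * pi) * (exp (- x\<^sup>2 / 2) * exp (- (s * (\<mu> * x + c)\<^sup>2 / 2)))"
      by (simp add: std_normal_density_def)
    then show ?thesis unfolding q2 n sq using D by (simp add: field_simps)
  qed
  have "(\<integral>\<^sup>+x. ennreal (exp (- (s * (\<mu> * x + c)\<^sup>2 / 2))) \<partial>density lborel std_normal_density)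
     = (\<integral>\<^sup>+x. ennreal (std_normal_density x * exp (- (s * (\<mu> * x + c)\<^sup>2 / 2))) \<partial>lborel)"
    by (subst nn_integral_density) (auto simp: ennreal_mult'[symmetric])
  also have "\<dots> = (\<integral>\<^sup>+x. ennreal (D powr (-1/2) * exp (- (c\<^sup>2 * (s / D) / 2))) * ennreal (normal_density (- (s * \<mu> * c / D)) (1 / sqrt D) x) \<partial>lborel)"
    unfolding e by (simp add: ennreal_mult')
  also have "\<dots> = ennreal (D powr (-1/2) * exp (- (c\<^sup>2 * (s / D) / 2))) * (\<integral>\<^sup>+x. ennreal (normal_density (- (s * \<mu> * c / D)) (1 / sqrt D) x) \<partial>lborel)"
    by (rule nn_integral_cmult) auto
  also have "(\<integral>\<^sup>+x. ennreal (normal_density (- (s * \<mu> * c / D)) (1 / sqrt D) x) \<partial>lborel) = 1"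
  proof -
    interpret prob_space "density lborel (normal_density (- (s * \<mu> * c / D)) (1 / sqrt D))"
      using D by (intro prob_space_normal_density) auto
    show ?thesis using emeasure_space_1 by (simp add: emeasure_density)
  qed
  finally show ?thesis by (simp add: D_def)
qed

text \<open>\<open>G\<close> is the gamma law of shape \<open>a\<close> and scale \<open>2\<close>. The degenerate case \<open>a = 0\<close> is included
  because the chi-square law with \<open>k - 1\<close> degrees of freedom is needed also for \<open>k = 1\<close>.\<close>
lemma ex_gamma_distribution:
  fixes a :: real
  assumes a: "a \<ge> 0"
  shows "\<exists>G. prob_space G \<and> sets G = sets (borel :: real measure) \<and> (AE x in G. 0 \<le> x \<and> (a > 0 \<longrightarrow> 0 < x))
    \<and> (\<forall>s > -1/2. (\<integral>\<^sup>+x. ennreal (exp (- (s * x))) \<partial>G) = ennreal ((1 + 2 * s) powr (- a)))"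
proof (cases "a = 0")
  case True
  show ?thesis
    by (rule exI[of _ "return borel 0"]) (auto simp: prob_space_return AE_return nn_integral_return True)
next
  case False
  with a have a: "a > 0" by simp
  obtain g where g: "g = Gamma a" "g > 0" using Gamma_real_pos[OF a] by blast
  define f where "f x = indicator {0<..} x * x powr (a - 1) * exp (- x / 2) / (2 powr a * g)" for x :: real
  have f0: "f x \<ge> 0" for x using g(2) by (auto simp: f_def indicator_def)
  have fm[measurable]: "f \<in> borel_measurable borel" unfolding f_def by measurable
  have I: "(\<integral>\<^sup>+x. ennreal (f x * exp (- (s * x))) \<partial>lborel) = ennreal ((1 + 2 * s) powr (- a))" if s: "s > -1/2" for s
  proof -
    \<comment> \<open>Tilting the density by exp(-s x) changes its rate from 1/2 to
      \<open>r\<close>; substituting \<open>r * x\<close> into the Gamma integral then evaluates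
      it.\<close>
    define r where "r = (1 + 2 * s) / 2"
    have r: "r > 0" using s by (simp add: r_def)
    have h: "ennreal (indicator {0..} (0 + r * x) * (0 + r * x) powr (a - 1) / exp (0 + r * x)) = 
       ennreal (2 powr a * g * r powr (a - 1)) * ennreal (f x * exp (- (s * x)))" for x
    proof (cases "x > 0")
      case True
      have "exp (- x / 2) * exp (- (s * x)) = 1 / exp (r * x)"
        by (simp add: exp_add[symmetric] exp_minus[symmetric] r_def field_simps)
      then show ?thesis using True r a g(2)
        by (subst ennreal_mult'[symmetric]) (auto simp: f_def powr_mult indicator_def zero_le_mult_iff)
    next
      case False
      then show ?thesis using r by (cases "x = 0") (auto simp: f_def indicator_def zero_le_mult_iff)
    qed
    have "ennreal g = ennreal r * (\<integral>\<^sup>+x. ennreal (indicator {0..} (0 + r * x) * (0 + r * x) powr (a - 1) / exp (0 + r * x)) \<partial>lborel)"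
      unfolding g(1) Gamma_conv_nn_integral_real[OF a] using r
      by (subst nn_integral_real_affine[of _ r 0]) auto
    also have "\<dots> = ennreal (r * (2 powr a * g * r powr (a - 1))) * (\<integral>\<^sup>+x. ennreal (f x * exp (- (s * x))) \<partial>lborel)"
      unfolding h using r by (subst nn_integral_cmult) (auto simp: ennreal_mult'[symmetric] mult.assoc[symmetric])
    also have "r * (2 powr a * g * r powr (a - 1)) = g * (2 * r) powr a"
      using r by (simp add: powr_diff powr_mult)
    finally have "ennreal (g) = ennreal (g * (2 * r) powr a) * (\<integral>\<^sup>+x. ennreal (f x * exp (- (s * x))) \<partial>lborel)" .
    then have "ennreal (1 / (g * (2 * r) powr a)) * ennreal (g) = 
       ennreal (1 / (g * (2 * r) powr a)) * (ennreal (g * (2 * r) powr a) * (\<integral>\<^sup>+x. ennreal (f x * exp (- (s * x))) \<partial>lborel))" by simp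
    also have "\<dots> = (\<integral>\<^sup>+x. ennreal (f x * exp (- (s * x))) \<partial>lborel)"
      using g(2) r by (simp add: mult.assoc[symmetric] ennreal_mult'[symmetric])
    also have "ennreal (1 / (g * (2 * r) powr a)) * ennreal (g) = ennreal ((2 * r) powr (- a))"
      using g(2) r by (simp add: ennreal_mult'[symmetric] powr_minus_divide)
    also have "2 * r = 1 + 2 * s" by (simp add: r_def)
    finally show ?thesis by simp
  qed
  have J: "(\<integral>\<^sup>+x. ennreal (exp (- (s * x))) \<partial>density lborel f) = ennreal ((1 + 2 * s) powr (- a))" if "s > -1/2" for s
    using I[OF that] by (subst nn_integral_density) (auto simp: ennreal_mult'[symmetric] f0)
  have "prob_space (density lborel f)"
    using J[of 0] by (intro prob_spaceI) (simp add: emeasure_density)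
  moreover have "AE x in density lborel f. 0 \<le> x \<and> (a > 0 \<longrightarrow> 0 < x)"
    by (subst AE_density) (auto simp: f_def indicator_def split: if_splits intro!: AE_I2)
  ultimately show ?thesis using J by (intro exI[of _ "density lborel f"]) auto
qed

section \<open>Borel-Cantelli lemmas for the coordinates of a product space\<close>

text \<open>Were all \<open>B n\<close> from some \<open>m\<close> on missed with positive
  probability, independence would bound this probability by exp of minus the partial sums of
  \<open>measure N (B n)\<close>; these sums would stay bounded and the series would
  converge.\<close>

lemma AE_PiM_frequently:
  fixes N :: "'a measure" and B :: "nat \<Rightarrow> 'a set"
  assumes N: "prob_space N" and B: "\<And>n. B n \<in> sets N"
    and ns: "\<not> summable (\<lambda>n. measure N (B n))"
  shows "AE \<omega> in PiM UNIV (\<lambda>_. N). \<exists>\<^sub>F n in sequentially. \<omega> n \<in> B n"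
proof -
  interpret N: prob_space N by fact
  interpret P: product_prob_space "\<lambda>_::nat. N" UNIV ..
  let ?P = "PiM UNIV (\<lambda>_::nat. N)"
  note B[measurable]
  have "AE \<omega> in ?P. \<exists>n\<ge>m. \<omega> n \<in> B n" for m
  proof -
    define E where "E k = {\<omega>\<in>space ?P. \<forall>n\<in>{m..<k}. \<omega> n \<notin> B n}" for k
    have Em[measurable]: "E k \<in> sets ?P" for k unfolding E_def by measurable
    define F where "F = {\<omega>\<in>space ?P. \<not> (\<exists>n\<ge>m. \<omega> n \<in> B n)}"
    have Fm[measurable]: "F \<in> sets ?P" unfolding F_def by measurable
    have le: "measure ?P F \<le> exp (- (\<Sum>n\<in>{m..<k}. measure N (B n)))" for k
    proof -
      have "E k = prod_emb UNIV (\<lambda>_. N) {m..<k} (Pi\<^sub>E {m..<k} (\<lambda>n. space N - B n))"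
        by (auto simp: E_def prod_emb_def space_PiM PiE_iff)
      then have "emeasure ?P (E k) = (\<Prod>n\<in>{m..<k}. emeasure N (space N - B n))"
        by (simp add: P.emeasure_PiM_emb)
      then have "measure ?P (E k) = (\<Prod>n\<in>{m..<k}. measure N (space N - B n))"
        by (simp add: P.P.emeasure_eq_measure N.emeasure_eq_measure prod_ennreal prod_nonneg)
      also have "\<dots> = (\<Prod>n\<in>{m..<k}. 1 - measure N (B n))" by (simp add: N.prob_compl)
      also have "\<dots> \<le> (\<Prod>n\<in>{m..<k}. exp (- measure N (B n)))"
        by (intro prod_mono conjI) (use exp_ge_add_one_self[of "- measure N (B n)" for n] in auto)
      also have "\<dots> = exp (- (\<Sum>n\<in>{m..<k}. measure N (B n)))" by (simp add: exp_sum sum_negf[symmetric])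
      finally have "measure ?P (E k) \<le> \<dots>" .
      moreover have "measure ?P F \<le> measure ?P (E k)"
        by (intro P.P.finite_measure_mono) (auto simp: E_def F_def)
      ultimately show ?thesis by simp
    qed
    have "measure ?P F \<le> 0"
    proof (rule ccontr)
      assume "\<not> measure ?P F \<le> 0"
      then have pos: "measure ?P F > 0" by simp
      have "(\<Sum>n<k. measure N (B n)) \<le> (\<Sum>n<m. measure N (B n)) - ln (measure ?P F)" for k
      proof -
        have "(\<Sum>n\<in>{m..<k}. measure N (B n)) \<le> - ln (measure ?P F)"
          using le[of k] pos by (metis ln_exp ln_mono minus_le_iff minus_minus neg_le_iff_le)
        moreover have "(\<Sum>n<k. measure N (B n)) \<le> (\<Sum>n\<in>{..<m} \<union> {m..<k}. measure N (B n))"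
          by (intro sum_mono2) auto
        moreover have "(\<Sum>n\<in>{..<m} \<union> {m..<k}. measure N (B n)) = (\<Sum>n<m. measure N (B n)) + (\<Sum>n\<in>{m..<k}. measure N (B n))"
          by (intro sum.union_disjoint) auto
        ultimately show ?thesis by linarith
      qed
      then have "summable (\<lambda>n. measure N (B n))" by (intro bounded_imp_summable[where B="(\<Sum>n<m. measure N (B n)) - ln (measure ?P F)"])
          (metis lessThan_Suc_atMost measure_nonneg)+
      then show False using ns by simp
    qed
    then have "measure ?P F = 0" by (simp add: measure_le_0_iff)
    then have "emeasure ?P F = 0" by (simp add: P.P.emeasure_eq_measure)
    then show ?thesis by (intro AE_I'[of F]) (auto simp: null_sets_def F_def)
  qed
  then have "AE \<omega> in ?P. \<forall>m. \<exists>n\<ge>m. \<omega> n \<in> B n" by (subst AE_all_countable) auto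
  then show ?thesis by (simp add: frequently_sequentially)
qed

lemma AE_PiM_eventually:
  fixes N :: "'a measure" and B :: "nat \<Rightarrow> 'a set"
  assumes N: "prob_space N" and B: "\<And>n. B n \<in> sets N"
    and s: "summable (\<lambda>n. measure N (B n))"
  shows "AE \<omega> in PiM UNIV (\<lambda>_. N). \<forall>\<^sub>F n in sequentially. \<omega> n \<notin> B n"
proof -
  interpret N: prob_space N by fact
  interpret P: product_prob_space "\<lambda>_::nat. N" UNIV ..
  let ?P = "PiM UNIV (\<lambda>_::nat. N)"
  note B[measurable]
  define E where "E n = {\<omega>\<in>space ?P. \<omega> n \<in> B n}" for n
  have Em: "E n \<in> sets ?P" for n unfolding E_def by measurable
  have "E n = prod_emb UNIV (\<lambda>_. N) {n} (Pi\<^sub>E {n} (\<lambda>n. B n))" for n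
    by (auto simp: E_def prod_emb_def space_PiM PiE_iff)
  then have "emeasure ?P (E n) = emeasure N (B n)" for n
    by (simp add: P.emeasure_PiM_emb)
  then have "measure ?P (E n) = measure N (B n)" for n by (simp add: measure_def)
  then have "AE \<omega> in ?P. \<forall>\<^sub>F n in sequentially. \<omega> \<in> space ?P - E n"
    using s by (intro borel_cantelli_AE1 Em) (auto simp: P.P.emeasure_eq_measure less_top[symmetric])
  then show ?thesis by (rule AE_mp) (auto intro!: AE_I2 elim: eventually_mono simp: E_def)
qed

text \<open>Coordinate \<open>0\<close> stands for \<open>X\<^sub>0\<close> and coordinate \<open>Suc n\<close> for \<open>X\<close> at \<open>1 / (n + N)\<close>, where \<open>N\<close>
  is a cut-off.\<close>
definition sqrt_lil :: "(nat \<Rightarrow> real) \<Rightarrow> real \<Rightarrow> (nat \<Rightarrow> real) \<Rightarrow> bool" where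
  "sqrt_lil r \<beta> x \<longleftrightarrow>
      limsup (\<lambda>n. ereal (\<bar>sqrt (x (Suc n)) - sqrt (x 0)\<bar> / r n)) = 1
    \<and> limsup (\<lambda>n. ereal ((sqrt (x (Suc n)) - sqrt (x 0)) / r n)) = 1
    \<and> liminf (\<lambda>n. ereal ((sqrt (x (Suc n)) - sqrt (x 0)) / r n)) =
        ereal (if \<beta> = 0 then - 1 else - min (sqrt (x 0) / sqrt \<beta>) 1)"

lemma measurable_sqrt_lil[measurable]: "Measurable.pred seq_borel (sqrt_lil r \<beta>)"
proof -
  have m: "(\<lambda>x. limsup (\<lambda>n. ereal (\<bar>sqrt (x (Suc n)) - sqrt (x 0)\<bar> / r n))) \<in> borel_measurable seq_borel"
    "(\<lambda>x. limsup (\<lambda>n. ereal ((sqrt (x (Suc n)) - sqrt (x 0)) / r n))) \<in> borel_measurable seq_borel"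
    "(\<lambda>x. liminf (\<lambda>n. ereal ((sqrt (x (Suc n)) - sqrt (x 0)) / r n))) \<in> borel_measurable seq_borel"
    "(\<lambda>x. ereal (if \<beta> = 0 then - 1 else - min (sqrt (x 0) / sqrt \<beta>) 1)) \<in> borel_measurable seq_borel"
    by measurable
  have "Measurable.pred seq_borel (\<lambda>x. a x = 1 \<and> b x = 1 \<and> c x = d x)"
    if [measurable]: "a \<in> borel_measurable seq_borel" "b \<in> borel_measurable seq_borel"
      "c \<in> borel_measurable seq_borel" "d \<in> borel_measurable seq_borel"
    for a b c d :: "(nat \<Rightarrow> real) \<Rightarrow> ereal"
    by (intro pred_intros_logic) (auto simp: pred_def intro!: borel_measurable_eq)
  from this[OF m] show ?thesis unfolding sqrt_lil_def .
qed

text \<open>A tail property apart from coordinate 0, which enters every term and the lower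
  limit.\<close>

lemma sqrt_lil_update:
  assumes "sqrt_lil r \<beta> x" "i > 0"
  shows "sqrt_lil r \<beta> (x(i := e))"
proof -
  have "\<forall>\<^sub>F n in sequentially. (x(i := e)) (Suc n) = x (Suc n)"
    using eventually_ge_at_top[of i] by eventually_elim auto
  then have "limsup (\<lambda>n. ereal (\<bar>sqrt ((x(i := e)) (Suc n)) - sqrt (x 0)\<bar> / r n)) = limsup (\<lambda>n. ereal (\<bar>sqrt (x (Suc n)) - sqrt (x 0)\<bar> / r n))"
    "limsup (\<lambda>n. ereal ((sqrt ((x(i := e)) (Suc n)) - sqrt (x 0)) / r n)) = limsup (\<lambda>n. ereal ((sqrt (x (Suc n)) - sqrt (x 0)) / r n))"
    "liminf (\<lambda>n. ereal ((sqrt ((x(i := e)) (Suc n)) - sqrt (x 0)) / r n)) = liminf (\<lambda>n. ereal ((sqrt (x (Suc n)) - sqrt (x 0)) / r n))"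
    by (auto intro!: Limsup_eq Liminf_eq elim!: eventually_mono)
  moreover have "(x(i := e)) 0 = x 0" using assms(2) by simp
  ultimately show ?thesis using assms(1) unfolding sqrt_lil_def by simp
qed

section \<open>Upper and lower limits for a fixed noise sequence\<close>

lemma limsup_ereal_eqI:
  fixes u :: "nat \<Rightarrow> real"
  assumes "\<And>e. e > 0 \<Longrightarrow> \<forall>\<^sub>F n in sequentially. u n \<le> c + e"
    and "\<And>e. e > 0 \<Longrightarrow> \<exists>\<^sub>F n in sequentially. c - e \<le> u n"
  shows "limsup (\<lambda>n. ereal (u n)) = ereal c"
proof (rule antisym)
  show "limsup (\<lambda>n. ereal (u n)) \<le> ereal c"
  proof (rule ereal_le_epsilon2)
    fix e :: real assume "0 < e"
    then show "limsup (\<lambda>n. ereal (u n)) \<le> ereal c + ereal e"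
      using assms(1) by (auto intro!: Limsup_bounded)
  qed
  show "ereal c \<le> limsup (\<lambda>n. ereal (u n))"
  proof (rule ccontr)
    assume "\<not> ereal c \<le> limsup (\<lambda>n. ereal (u n))"
    then obtain z where z: "limsup (\<lambda>n. ereal (u n)) < ereal z" "ereal z < ereal c"
      using ereal_dense2 by (meson not_le)
    have "\<forall>\<^sub>F n in sequentially. ereal (u n) < ereal z" using z(1) by (rule Limsup_lessD)
    then have "\<forall>\<^sub>F n in sequentially. \<not> (c - (c - z) \<le> u n)" by eventually_elim auto
    moreover have "\<exists>\<^sub>F n in sequentially. c - (c - z) \<le> u n" using z(2) by (intro assms(2)) auto
    ultimately show False by (simp add: frequently_def)
  qed
qed

lemma liminf_ereal_eqI:
  fixes u :: "nat \<Rightarrow> real"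
  assumes "\<And>e. e > 0 \<Longrightarrow> \<forall>\<^sub>F n in sequentially. c - e \<le> u n"
    and "\<And>e. e > 0 \<Longrightarrow> \<exists>\<^sub>F n in sequentially. u n \<le> c + e"
  shows "liminf (\<lambda>n. ereal (u n)) = ereal c"
proof -
  have "limsup (\<lambda>n. ereal (- u n)) = ereal (- c)"
  proof (rule limsup_ereal_eqI)
    fix e :: real assume e: "e > 0"
    show "\<forall>\<^sub>F n in sequentially. - u n \<le> - c + e"
      using assms(1)[OF e] by eventually_elim auto
    show "\<exists>\<^sub>F n in sequentially. - c - e \<le> - u n"
      using assms(2)[OF e] by (rule frequently_elim1) auto
  qed
  then show ?thesis using ereal_Liminf_uminus[of sequentially "\<lambda>n. ereal (- u n)"] by simp
qed

text \<open>\<open>sqrt (x (Suc n))\<close> is the length of the plane vector (t + c, v) with c =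
  sqrt (x 0). By the triangle inequality it differs from c by at most the length of the noise (t,
  v), and it is nonnegative; these two constraints produce the minimum in the lower limit. The
  hypotheses use only the slacks \<open>inverse (real (Suc m))\<close> and rational
  \<open>\<theta>\<close>, so that for random noise only countably many null sets have to be
  discarded.\<close>

lemma sqrt_lil_of_noise:
  fixes l L \<eta> V :: "nat \<Rightarrow> real" and z \<beta> v0 :: real
  assumes l: "\<And>n. l n > 0" and l0: "l \<longlonglongrightarrow> 0"
    and L: "\<And>n. L n > 0" and Linf: "filterlim L at_top sequentially"
    and lL: "(\<lambda>n. l n * L n) \<longlonglongrightarrow> \<beta>" and \<beta>: "\<beta> \<ge> 0"
    and z: "z > 0" and V: "\<And>n. V n \<ge> 0" and v0: "v0 \<ge> 0"
    and upper: "\<And>m::nat. \<forall>\<^sub>F n in sequentially. (\<eta> n)\<^sup>2 + V n \<le> 2 * (1 + inverse (real (Suc m))) * L n"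
    and plus: "\<And>\<theta>. \<lbrakk>\<theta> \<in> \<rat>; 0 < \<theta>; \<theta> < 1\<rbrakk> \<Longrightarrow> \<exists>\<^sub>F n in sequentially. \<theta> * sqrt (2 * L n) \<le> \<eta> n"
    and minus: "\<And>\<theta>. \<lbrakk>\<theta> \<in> \<rat>; 0 < \<theta>; \<theta> < 1\<rbrakk> \<Longrightarrow> \<exists>\<^sub>F n in sequentially.
        - (\<theta> * sqrt (2 * L n)) - 1 \<le> \<eta> n \<and> \<eta> n \<le> - (\<theta> * sqrt (2 * L n)) \<and> V n \<le> v0"
    and x0: "x 0 = z"
    and xS: "\<And>n. x (Suc n) = (sqrt (l n) * \<eta> n + sqrt (2 * z))\<^sup>2 / 2 + l n * V n / 2"
  shows "sqrt_lil (\<lambda>n. sqrt (l n * L n)) \<beta> x"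
proof -
  define c where "c = sqrt z"
  define R where "R n = sqrt (l n * L n)" for n
  define t where "t n = sqrt (l n / 2) * \<eta> n" for n
  define v where "v n = sqrt (l n / 2) * sqrt (V n)" for n
  define d where "d n = (sqrt (x (Suc n)) - sqrt (x 0)) / R n" for n
  have c: "c > 0" using z by (simp add: c_def)
  have R: "R n > 0" for n using l L by (simp add: R_def)
  have RL: "sqrt (2 * L n) * sqrt (l n / 2) = R n" for n
    by (simp add: R_def real_sqrt_mult[symmetric] mult.commute)
  have v: "v n \<ge> 0" "(v n)\<^sup>2 = l n * V n / 2" for n
    using l[of n] V[of n] by (auto simp: v_def power_mult_distrib)
  have xe: "x (Suc n) = (t n + c)\<^sup>2 + (v n)\<^sup>2" for n
  proof -
    have "sqrt (l n) = sqrt 2 * sqrt (l n / 2)" "sqrt (2 * z) = sqrt 2 * c"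
      by (simp_all add: real_sqrt_divide real_sqrt_mult c_def)
    then have "sqrt (l n) * \<eta> n + sqrt (2 * z) = sqrt 2 * (t n + c)" by (simp add: t_def algebra_simps)
    then show ?thesis by (simp add: xS v power_mult_distrib)
  qed
  have sx0: "sqrt (x 0) = c" by (simp add: x0 c_def)
  have tri: "\<bar>sqrt (x (Suc n)) - c\<bar> \<le> sqrt ((t n)\<^sup>2 + (v n)\<^sup>2)" for n
  proof -
    have "sqrt ((t n + c)\<^sup>2 + (v n + 0)\<^sup>2) \<le> sqrt ((t n)\<^sup>2 + (v n)\<^sup>2) + sqrt (c\<^sup>2 + 0\<^sup>2)"
      by (rule real_sqrt_sum_squares_triangle_ineq)
    moreover have "sqrt (((t n + c) + (- t n))\<^sup>2 + (v n + - v n)\<^sup>2) \<le> sqrt ((t n + c)\<^sup>2 + (v n)\<^sup>2) + sqrt ((- t n)\<^sup>2 + (- v n)\<^sup>2)"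
      by (rule real_sqrt_sum_squares_triangle_ineq)
    ultimately show ?thesis using c by (simp add: xe)
  qed
  have tv: "sqrt ((t n)\<^sup>2 + (v n)\<^sup>2) = sqrt (l n / 2) * sqrt ((\<eta> n)\<^sup>2 + V n)" for n
    using l[of n] v(2)[of n] by (simp add: t_def power_mult_distrib real_sqrt_mult[symmetric] distrib_left)
  have ub: "\<forall>\<^sub>F n in sequentially. \<bar>d n\<bar> \<le> 1 + e" if e: "e > 0" for e
  proof -
    obtain m where m: "inverse (real (Suc m)) < e" using reals_Archimedean[OF e] by auto
    show ?thesis using upper[of m]
    proof eventually_elim
      case (elim n)
      have "(\<eta> n)\<^sup>2 + V n \<le> (1 + e)\<^sup>2 * (2 * L n)"
      proof -
        have "1 + inverse (real (Suc m)) \<le> 1 + e" using m by simp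
        also have "\<dots> \<le> (1 + e)\<^sup>2" using e by (simp add: power2_eq_square algebra_simps)
        finally have "(1 + inverse (real (Suc m))) * (2 * L n) \<le> (1 + e)\<^sup>2 * (2 * L n)"
          using L[of n] by (intro mult_right_mono) auto
        then show ?thesis using elim by (simp add: mult_ac)
      qed
      then have "sqrt ((\<eta> n)\<^sup>2 + V n) \<le> (1 + e) * sqrt (2 * L n)"
        using e by (intro real_le_lsqrt) (auto simp: power_mult_distrib less_imp_le[OF L] V)
      then have "sqrt (l n / 2) * sqrt ((\<eta> n)\<^sup>2 + V n) \<le> sqrt (l n / 2) * ((1 + e) * sqrt (2 * L n))"
        using l[of n] by (intro mult_left_mono) auto
      also have "\<dots> = (1 + e) * R n" using RL[of n] by (simp add: mult_ac)
      finally show ?case using tri[of n] R[of n] by (simp add: d_def sx0 tv divide_le_eq)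
    qed
  qed
  have lb: "\<exists>\<^sub>F n in sequentially. 1 - e \<le> d n" if e: "e > 0" for e
  proof -
    obtain \<theta> where th: "\<theta> \<in> \<rat>" "max 0 (1 - e) < \<theta>" "\<theta> < 1" using Rats_dense_in_real[of "max 0 (1 - e)" 1] e by auto
    have "\<exists>\<^sub>F n in sequentially. \<theta> * sqrt (2 * L n) \<le> \<eta> n" using th by (intro plus) auto
    then show ?thesis
    proof (rule frequently_elim1)
      fix n assume n: "\<theta> * sqrt (2 * L n) \<le> \<eta> n"
      have "sqrt (l n / 2) * (\<theta> * sqrt (2 * L n)) \<le> t n" unfolding t_def using l[of n] n by (intro mult_left_mono) auto
      then have t: "\<theta> * R n \<le> t n" using RL[of n] by (simp add: mult_ac)
      have "t n + c \<le> sqrt (x (Suc n))" unfolding xe by (rule order_trans[OF _ real_sqrt_sum_squares_ge1]) simp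
      then have "\<theta> * R n \<le> sqrt (x (Suc n)) - c" using t by simp
      then have "\<theta> \<le> d n" using R[of n] by (simp add: d_def sx0 le_divide_eq)
      then show "1 - e \<le> d n" using th by simp
    qed
  qed
  have Rlim: "R \<longlonglongrightarrow> sqrt \<beta>" unfolding R_def by (intro tendsto_intros lL)
  \<comment> \<open>Minus the value claimed for the lower limit; for \<open>\<beta> = 0\<close> the
    quotient c / sqrt \<beta> is read as infinite.\<close>
  define \<kappa> where "\<kappa> = (if \<beta> = 0 then 1 else min (c / sqrt \<beta>) 1)"
  have \<kappa>: "0 < \<kappa>" "\<kappa> \<le> 1" using c \<beta> by (auto simp: \<kappa>_def)
  have "limsup (\<lambda>n. ereal \<bar>d n\<bar>) = ereal 1"
  proof (rule limsup_ereal_eqI)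
    fix e :: real assume "e > 0"
    show "\<exists>\<^sub>F n in sequentially. 1 - e \<le> \<bar>d n\<bar>" using lb[OF \<open>e > 0\<close>] by (rule frequently_elim1) auto
  qed (use ub in auto)
  moreover have "limsup (\<lambda>n. ereal (d n)) = ereal 1"
  proof (rule limsup_ereal_eqI)
    fix e :: real assume "e > 0"
    show "\<forall>\<^sub>F n in sequentially. d n \<le> 1 + e" using ub[OF \<open>e > 0\<close>] by eventually_elim auto
  qed (use lb in auto)
  moreover have "liminf (\<lambda>n. ereal (d n)) = ereal (- \<kappa>)"
  proof (rule liminf_ereal_eqI)
    fix e :: real assume e: "e > 0"
    show "\<forall>\<^sub>F n in sequentially. - \<kappa> - e \<le> d n"
    proof (cases "\<kappa> = 1")
      case True
      then show ?thesis using ub[OF e] by (auto elim: eventually_mono)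
    next
      case False
      \<comment> \<open>For \<open>\<kappa> < 1\<close> the binding constraint is that the square
        root is nonnegative, which gives \<open>d n \<ge> - (c / R n)\<close>.\<close>
      then have b: "\<beta> > 0" "\<kappa> = c / sqrt \<beta>" using \<beta> by (auto simp: \<kappa>_def min_def split: if_splits)
      have "(\<lambda>n. c / R n) \<longlonglongrightarrow> c / sqrt \<beta>" using b by (intro tendsto_intros Rlim) auto
      then have "\<forall>\<^sub>F n in sequentially. c / R n < \<kappa> + e" using e b by (intro order_tendstoD) auto
      then show ?thesis
      proof eventually_elim
        case (elim n)
        have "(- c) / R n \<le> (sqrt (x (Suc n)) - c) / R n"
          using R[of n] by (intro divide_right_mono) (auto simp: xe)
        then have "- (c / R n) \<le> d n" by (simp add: d_def sx0)
        then show ?case using elim by simp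
      qed
    qed
    \<comment> \<open>Taking \<open>\<theta>\<close> below \<open>\<kappa>\<close>, not merely below
      1, keeps t + c positive: the noise shortens the vector without pushing it through the
      origin.\<close>
    obtain \<theta> where th: "\<theta> \<in> \<rat>" "max 0 (\<kappa> - e / 2) < \<theta>" "\<theta> < \<kappa>" using Rats_dense_in_real[of "max 0 (\<kappa> - e / 2)" \<kappa>] e \<kappa> by auto
    have pos: "c - \<theta> * sqrt \<beta> - 0 > 0"
    proof (cases "\<beta> = 0")
      case True then show ?thesis using c by simp
    next
      case False
      then have "\<theta> < c / sqrt \<beta>" using th by (auto simp: \<kappa>_def)
      then show ?thesis using False \<beta> by (simp add: less_divide_eq)
    qed
    \<comment> \<open>The term \<open>sqrt (l n / 2)\<close> comes from the slack of 1 in the window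
      for \<open>\<eta>\<close>; it vanishes in the limit because \<open>l\<close> does.\<close>
    have "(\<lambda>n. c - \<theta> * R n - sqrt (l n / 2)) \<longlonglongrightarrow> c - \<theta> * sqrt \<beta> - sqrt (0 / 2)"
      by (intro tendsto_intros Rlim l0) auto
    then have A: "\<forall>\<^sub>F n in sequentially. 0 < c - \<theta> * R n - sqrt (l n / 2)" using pos by (intro order_tendstoD) auto
    \<comment> \<open>When \<open>V n \<le> v0\<close>, this bounds the quotient of
      \<open>v n\<close> by \<open>R n\<close>; the transversal noise is negligible because
      \<open>L\<close> tends to infinity.\<close>
    have "(\<lambda>n. sqrt (v0 / 2 * inverse (L n))) \<longlonglongrightarrow> sqrt (v0 / 2 * 0)"
      by (intro tendsto_intros tendsto_inverse_0_at_top Linf)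
    then have B: "\<forall>\<^sub>F n in sequentially. sqrt (v0 / 2 * inverse (L n)) < e / 2" using e by (intro order_tendstoD) auto
    have "\<exists>\<^sub>F n in sequentially. - (\<theta> * sqrt (2 * L n)) - 1 \<le> \<eta> n \<and> \<eta> n \<le> - (\<theta> * sqrt (2 * L n)) \<and> V n \<le> v0"
      using th \<kappa> by (intro minus) auto
    then have "\<exists>\<^sub>F n in sequentially. (- (\<theta> * sqrt (2 * L n)) - 1 \<le> \<eta> n \<and> \<eta> n \<le> - (\<theta> * sqrt (2 * L n)) \<and> V n \<le> v0)
       \<and> (0 < c - \<theta> * R n - sqrt (l n / 2) \<and> sqrt (v0 / 2 * inverse (L n)) < e / 2)"
      by (rule frequently_rev_mp) (use A B in \<open>eventually_elim, simp\<close>)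
    then show "\<exists>\<^sub>F n in sequentially. d n \<le> - \<kappa> + e"
    proof (rule frequently_elim1)
      fix n assume n: "(- (\<theta> * sqrt (2 * L n)) - 1 \<le> \<eta> n \<and> \<eta> n \<le> - (\<theta> * sqrt (2 * L n)) \<and> V n \<le> v0)
       \<and> (0 < c - \<theta> * R n - sqrt (l n / 2) \<and> sqrt (v0 / 2 * inverse (L n)) < e / 2)"
      have "sqrt (l n / 2) * (- (\<theta> * sqrt (2 * L n)) - 1) \<le> t n" "t n \<le> sqrt (l n / 2) * (- (\<theta> * sqrt (2 * L n)))"
        unfolding t_def using l[of n] n by (intro mult_left_mono; auto)+
      then have t: "- \<theta> * R n - sqrt (l n / 2) \<le> t n" "t n \<le> - \<theta> * R n"
        using RL[of n] by (simp_all add: algebra_simps)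
      have "sqrt (x (Suc n)) \<le> \<bar>t n + c\<bar> + \<bar>v n\<bar>" unfolding xe by (rule sqrt_sum_squares_le_sum_abs)
      then have "sqrt (x (Suc n)) - c \<le> - \<theta> * R n + v n" using t n v(1)[of n] by simp
      also have "v n \<le> sqrt (l n / 2) * sqrt v0" unfolding v_def using n l[of n] by (intro mult_left_mono) auto
      also have "\<dots> = R n * sqrt (v0 / 2 * inverse (L n))"
        using L[of n] by (simp add: R_def real_sqrt_mult[symmetric] field_simps)
      also have "\<dots> \<le> R n * (e / 2)" using n R[of n] by (intro mult_left_mono) auto
      finally have "sqrt (x (Suc n)) - c \<le> (- \<theta> + e / 2) * R n" by (simp add: algebra_simps)
      then have "d n \<le> - \<theta> + e / 2" using R[of n] by (simp add: d_def sx0 divide_le_eq)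
      then show "d n \<le> - \<kappa> + e" using th by simp
    qed
  qed
  moreover have "\<bar>sqrt (x (Suc n)) - sqrt (x 0)\<bar> / R n = \<bar>d n\<bar>" for n
    using R[of n] by (simp add: d_def)
  moreover have "(if \<beta> = 0 then - 1 else - min (sqrt (x 0) / sqrt \<beta>) 1) = - \<kappa>"
    by (simp add: \<kappa>_def sx0)
  ultimately show ?thesis
    unfolding sqrt_lil_def R_def[symmetric] d_def[symmetric] by (simp only: one_ereal_def)
qed

section \<open>Random noise: a Gaussian and an independent chi-square part\<close>

lemma nn_integral_PiM_UNIV_prod:
  fixes N :: "'a measure" and \<phi> :: "nat \<Rightarrow> 'a \<Rightarrow> ennreal"
  assumes N: "prob_space N" and \<phi>: "\<And>i. \<phi> i \<in> borel_measurable N"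
  shows "(\<integral>\<^sup>+\<omega>. (\<Prod>i<m. \<phi> i (\<omega> i)) \<partial>PiM UNIV (\<lambda>_. N)) = (\<Prod>i<m. \<integral>\<^sup>+x. \<phi> i x \<partial>N)"
proof -
  interpret N: prob_space N by fact
  interpret P: product_prob_space "\<lambda>_::nat. N" UNIV ..
  note \<phi>[measurable]
  have "(\<integral>\<^sup>+\<omega>. (\<Prod>i<m. \<phi> i (\<omega> i)) \<partial>PiM UNIV (\<lambda>_. N))
      = (\<integral>\<^sup>+\<omega>. (\<Prod>i<m. \<phi> i (restrict \<omega> {..<m} i)) \<partial>PiM UNIV (\<lambda>_. N))"
    by (intro nn_integral_cong prod.cong) auto
  also have "\<dots> = (\<integral>\<^sup>+\<omega>. (\<Prod>i<m. \<phi> i (\<omega> i)) \<partial>distr (PiM UNIV (\<lambda>_. N)) (PiM {..<m} (\<lambda>_. N)) (\<lambda>\<omega>. restrict \<omega> {..<m}))"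
    by (subst nn_integral_distr) auto
  also have "\<dots> = (\<integral>\<^sup>+\<omega>. (\<Prod>i<m. \<phi> i (\<omega> i)) \<partial>PiM {..<m} (\<lambda>_. N))"
    by (subst P.distr_PiM_restrict_finite) auto
  also have "\<dots> = (\<Prod>i<m. \<integral>\<^sup>+x. \<phi> i x \<partial>N)"
    by (rule P.product_nn_integral_prod) auto
  finally show ?thesis .
qed

lemma prob_space_std_normal_distribution: "prob_space std_normal_distribution"
  by (intro prob_space_normal_density) auto

text \<open>The window has length one, and on the large interval the density is smallest at the
  ends.\<close>

lemma std_normal_interval_ge:
  fixes a u :: real
  assumes "{u..u + 1} \<subseteq> {-(a + 1)..a + 1}"
  shows "std_normal_density (a + 1) \<le> measure std_normal_distribution {u..u + 1}"
proof -
  interpret prob_space std_normal_distribution by (rule prob_space_std_normal_distribution)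
  have "ennreal (std_normal_density (a + 1)) = (\<integral>\<^sup>+x. ennreal (std_normal_density (a + 1)) * indicator {u..u + 1} x \<partial>lborel)"
    by (subst nn_integral_cmult_indicator) auto
  also have "\<dots> \<le> (\<integral>\<^sup>+x. ennreal (std_normal_density x) * indicator {u..u + 1} x \<partial>lborel)"
  proof (rule nn_integral_mono)
    fix x :: real
    have "std_normal_density (a + 1) \<le> std_normal_density x" if "x \<in> {u..u + 1}"
    proof -
      have "\<bar>x\<bar> \<le> \<bar>a + 1\<bar>" using that assms by auto
      then have "x\<^sup>2 \<le> (a + 1)\<^sup>2" by (simp add: abs_le_square_iff)
      then show ?thesis by (simp add: std_normal_density_def divide_right_mono)
    qed
    then show "ennreal (std_normal_density (a + 1)) * indicator {u..u + 1} x \<le> ennreal (std_normal_density x) * indicator {u..u + 1} x"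
      by (auto simp: indicator_def intro: ennreal_leI)
  qed
  also have "\<dots> = emeasure std_normal_distribution {u..u + 1}"
    by (subst emeasure_density) auto
  finally show ?thesis by (simp add: emeasure_eq_measure)
qed

text \<open>A Chernoff bound followed by the convergence half of Borel-Cantelli: by
  \<open>lap\<close> and the Gaussian integral, the squared length of the noise has exponential
  moments of every order below 1/2.\<close>

lemma noise_upper:
  fixes W :: "real measure" and b :: real
  assumes W: "prob_space W" "sets W = sets borel"
    and lap: "\<And>s. s > -1/2 \<Longrightarrow> (\<integral>\<^sup>+x. ennreal (exp (- (s * x))) \<partial>W) = ennreal ((1 + 2 * s) powr (- b))"
    and e: "e > 0" and N: "N \<ge> (2::nat)"
  shows "AE \<omega> in PiM UNIV (\<lambda>_. std_normal_distribution \<Otimes>\<^sub>M W). \<forall>\<^sub>F n in sequentially.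
    (fst (\<omega> n))\<^sup>2 + snd (\<omega> n) \<le> 2 * (1 + e) * ln (real (n + N))"
proof -
  interpret G: prob_space std_normal_distribution by (rule prob_space_std_normal_distribution)
  interpret C: prob_space W by fact
  interpret GC: pair_prob_space std_normal_distribution W ..
  note W(2)[measurable_cong]
  let ?N = "std_normal_distribution \<Otimes>\<^sub>M W"
  \<comment> \<open>\<open>\<theta> < 1\<close> makes the exponential moment of order
    \<open>\<theta> / 2\<close> finite, and \<open>\<theta> * (1 + e) = 1 + e / 2\<close> makes
    Markov's inequality yield a power of \<open>n + N\<close> with exponent below -1.\<close>
  define \<theta> where "\<theta> = (1 + e / 2) / (1 + e)"
  have th: "0 < \<theta>" "\<theta> < 1" "\<theta> * (1 + e) = 1 + e / 2" using e by (auto simp: \<theta>_def divide_simps)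
  define K where "K = (1 - \<theta>) powr (-1/2) * (1 - \<theta>) powr (- b)"
  have mgf: "(\<integral>\<^sup>+y. ennreal (exp (\<theta> * ((fst y)\<^sup>2 + snd y) / 2)) \<partial>?N) = ennreal K"
  proof -
    have "(\<integral>\<^sup>+y. ennreal (exp (\<theta> * ((fst y)\<^sup>2 + snd y) / 2)) \<partial>?N)
       = (\<integral>\<^sup>+x. (\<integral>\<^sup>+v. ennreal (exp (- (- \<theta> * (1 * x + 0)\<^sup>2 / 2))) * ennreal (exp (- (- \<theta> / 2 * v))) \<partial>W) \<partial>std_normal_distribution)"
      by (subst C.nn_integral_fst[symmetric]) (auto simp: ennreal_mult'[symmetric] exp_add[symmetric] field_simps intro!: nn_integral_cong)
    also have "\<dots> = (\<integral>\<^sup>+x. ennreal (exp (- (- \<theta> * (1 * x + 0)\<^sup>2 / 2))) \<partial>std_normal_distribution) * (\<integral>\<^sup>+v. ennreal (exp (- (- \<theta> / 2 * v))) \<partial>W)"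
      by (simp add: nn_integral_cmult nn_integral_multc)
    also have "\<dots> = ennreal K"
      using nn_integral_normal_exp_square[of 1 "- \<theta>" 0] lap[of "- \<theta> / 2"] th
      by (simp add: K_def ennreal_mult'[symmetric])
    finally show ?thesis .
  qed
  define B where "B n = {y \<in> space ?N. 2 * (1 + e) * ln (real (n + N)) < (fst y)\<^sup>2 + snd y}" for n
  have B: "B n \<in> sets ?N" for n unfolding B_def by measurable
  have le: "measure ?N (B n) \<le> K * real (n + N) powr (- (1 + e / 2))" for n
  proof -
    define c where "c = real (n + N) powr (- (1 + e / 2))"
    have c: "c > 0" using N by (simp add: c_def)
    have "emeasure ?N (B n) \<le> emeasure ?N ({y \<in> space ?N. 1 \<le> ennreal c * ennreal (exp (\<theta> * ((fst y)\<^sup>2 + snd y) / 2))})"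
    proof (rule emeasure_mono)
      show "B n \<subseteq> {y \<in> space ?N. 1 \<le> ennreal c * ennreal (exp (\<theta> * ((fst y)\<^sup>2 + snd y) / 2))}"
      proof
        fix y assume y: "y \<in> B n"
        have "(1 + e / 2) * ln (real (n + N)) = \<theta> * (2 * (1 + e) * ln (real (n + N))) / 2"
          unfolding th(3)[symmetric] by simp
        also have "\<dots> \<le> \<theta> * ((fst y)\<^sup>2 + snd y) / 2"
          using y th by (intro divide_right_mono mult_left_mono) (auto simp: B_def)
        finally have "1 \<le> exp (- ((1 + e / 2) * ln (real (n + N))) + \<theta> * ((fst y)\<^sup>2 + snd y) / 2)" by simp
        also have "\<dots> = c * exp (\<theta> * ((fst y)\<^sup>2 + snd y) / 2)"
        proof -
          have "c = exp (- ((1 + e / 2) * ln (real (n + N))))" using N by (simp add: c_def powr_def algebra_simps)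
          then show ?thesis by (simp only: exp_add)
        qed
        finally show "y \<in> {y \<in> space ?N. 1 \<le> ennreal c * ennreal (exp (\<theta> * ((fst y)\<^sup>2 + snd y) / 2))}"
          using y c by (auto simp: B_def ennreal_mult'[symmetric])
      qed
    qed measurable
    also have "\<dots> \<le> ennreal c * (\<integral>\<^sup>+y. ennreal (exp (\<theta> * ((fst y)\<^sup>2 + snd y) / 2)) * indicator (space ?N) y \<partial>?N)"
      by (rule nn_integral_Markov_inequality) measurable
    also have "(\<integral>\<^sup>+y. ennreal (exp (\<theta> * ((fst y)\<^sup>2 + snd y) / 2)) * indicator (space ?N) y \<partial>?N) = ennreal K"
      unfolding mgf[symmetric] by (intro nn_integral_cong) auto
    finally have "ennreal (measure ?N (B n)) \<le> ennreal (K * c)"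
      using c by (simp add: GC.P.emeasure_eq_measure ennreal_mult'' mult.commute)
    moreover have "0 \<le> K * c" using th c by (simp add: K_def)
    ultimately have "measure ?N (B n) \<le> K * c" by (simp only: ennreal_le_iff)
    then show ?thesis by (simp only: c_def)
  qed
  have "summable (\<lambda>n. K * real (n + N) powr (- (1 + e / 2)))"
  proof (rule summable_mult)
    have "summable (\<lambda>n. real n powr (- (1 + e / 2)))" using e by (subst summable_real_powr_iff) auto
    then show "summable (\<lambda>n. real (n + N) powr (- (1 + e / 2)))" by (rule summable_ignore_initial_segment)
  qed
  then have "summable (\<lambda>n. measure ?N (B n))"
    by (rule summable_comparison_test') (use le in auto)
  from AE_PiM_eventually[OF GC.P.prob_space_axioms B this]
  show ?thesis
  proof (rule AE_mp, intro AE_I2 impI)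
    fix \<omega> assume w: "\<omega> \<in> space (PiM UNIV (\<lambda>_. ?N))" and ev: "\<forall>\<^sub>F n in sequentially. \<omega> n \<notin> B n"
    have "\<omega> n \<in> space ?N" for n using w by (auto simp: space_PiM)
    with ev show "\<forall>\<^sub>F n in sequentially. (fst (\<omega> n))\<^sup>2 + snd (\<omega> n) \<le> 2 * (1 + e) * ln (real (n + N))"
      by (auto simp: B_def not_less elim!: eventually_mono)
  qed
qed

text \<open>The window stays within distance
  \<open>\<theta> * sqrt (2 * ln (real (n + N))) + 1\<close> of the origin, eventually less than
  \<open>sqrt (2 * ln (real (n + N)))\<close>, and there the Gaussian density is at least a constant
  over n + N; the harmonic series diverges. A general \<open>u\<close> serves windows on both sides
  of zero, and the independent event \<open>snd (\<omega> n) \<le> v0\<close> costs only a constant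
  factor.\<close>

lemma noise_lower:
  fixes W :: "real measure" and u :: "nat \<Rightarrow> real"
  assumes W: "prob_space W" "sets W = sets borel"
    and v0: "measure W {..v0} > 0" and th: "0 < \<theta>" "\<theta> < 1" and N: "N \<ge> (2::nat)"
    and u: "\<And>n. {u n..u n + 1} \<subseteq> {-(\<theta> * sqrt (2 * ln (real (n + N))) + 1)..\<theta> * sqrt (2 * ln (real (n + N))) + 1}"
  shows "AE \<omega> in PiM UNIV (\<lambda>_. std_normal_distribution \<Otimes>\<^sub>M W). \<exists>\<^sub>F n in sequentially.
    u n \<le> fst (\<omega> n) \<and> fst (\<omega> n) \<le> u n + 1 \<and> snd (\<omega> n) \<le> v0"
proof -
  interpret G: prob_space std_normal_distribution by (rule prob_space_std_normal_distribution)
  interpret C: prob_space W by fact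
  interpret GC: pair_prob_space std_normal_distribution W ..
  note W(2)[measurable_cong]
  let ?N = "std_normal_distribution \<Otimes>\<^sub>M W"
  define L where "L n = sqrt (2 * ln (real (n + N)))" for n
  define B where "B n = {u n..u n + 1} \<times> {..v0}" for n
  have B: "B n \<in> sets ?N" for n unfolding B_def by measurable
  have mB: "measure ?N (B n) = measure std_normal_distribution {u n..u n + 1} * measure W {..v0}" for n
    unfolding B_def measure_def
    by (subst C.emeasure_pair_measure_Times) (auto simp: W(2) enn2real_mult)
  have ge: "std_normal_density (\<theta> * L n + 1) \<le> measure std_normal_distribution {u n..u n + 1}" for n
    by (rule std_normal_interval_ge) (use u in \<open>simp add: L_def\<close>)
  have "filterlim (\<lambda>n. ln (real (n + N))) at_top sequentially"
    by (intro filterlim_compose[OF ln_at_top] filterlim_compose[OF filterlim_real_sequentially] filterlim_add_const_nat_at_top)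
  \<comment> \<open>From this threshold on, \<open>1 / (1 - \<theta>) \<le> L n\<close>, which is
    the same as \<open>\<theta> * L n + 1 \<le> L n\<close>.\<close>
  then have "\<forall>\<^sub>F n in sequentially. (1 / (1 - \<theta>))\<^sup>2 \<le> ln (real (n + N))"
    by (auto simp: filterlim_at_top)
  then have ev: "\<forall>\<^sub>F n in sequentially. norm (inverse (real (n + N))) \<le> sqrt (2 * pi) / measure W {..v0} * measure ?N (B n)"
  proof eventually_elim
    case (elim n)
    have "ln (real (n + N)) \<ge> 0" using N by simp
    then have "(1 / (1 - \<theta>))\<^sup>2 \<le> 2 * ln (real (n + N))" using elim by linarith
    then have "1 / (1 - \<theta>) \<le> L n" unfolding L_def by (rule real_le_rsqrt)
    then have "\<theta> * L n + 1 \<le> L n" using th by (simp add: field_simps)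
    moreover have "0 \<le> L n" using \<open>ln (real (n + N)) \<ge> 0\<close> by (simp add: L_def)
    ultimately have "(\<theta> * L n + 1)\<^sup>2 \<le> (L n)\<^sup>2" using th by (intro power_mono) auto
    also have "(L n)\<^sup>2 = 2 * ln (real (n + N))" using \<open>ln (real (n + N)) \<ge> 0\<close> by (simp add: L_def)
    finally have "exp (- ln (real (n + N))) \<le> exp (- (\<theta> * L n + 1)\<^sup>2 / 2)" by simp
    also have "\<dots> = sqrt (2 * pi) * std_normal_density (\<theta> * L n + 1)" by (simp add: std_normal_density_def)
    also have "\<dots> \<le> sqrt (2 * pi) * measure std_normal_distribution {u n..u n + 1}" using ge by (intro mult_left_mono) auto
    also have "\<dots> = sqrt (2 * pi) / measure W {..v0} * measure ?N (B n)" using v0 by (simp add: mB)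
    finally show ?case using N by (simp add: exp_minus)
  qed
  have "\<not> summable (\<lambda>n. measure ?N (B n))"
  proof
    assume "summable (\<lambda>n. measure ?N (B n))"
    then have "summable (\<lambda>n. sqrt (2 * pi) / measure W {..v0} * measure ?N (B n))" by (rule summable_mult)
    then have "summable (\<lambda>n. inverse (real (n + N)))" using ev by (rule summable_comparison_test_ev[rotated])
    then have "summable (\<lambda>n. inverse (real n))" by (subst (asm) summable_iff_shift)
    then show False using not_summable_harmonic by blast
  qed
  from AE_PiM_frequently[OF GC.P.prob_space_axioms B this]
  show ?thesis
    by (rule AE_mp) (auto intro!: AE_I2 simp: B_def mem_Times_iff elim!: frequently_elim1)
qed

text \<open>A noncentral chi-square law: the first axis carries a Gaussian with the whole offset,
  \<open>W\<close> the other 2 b degrees of freedom. As \<open>z\<close> enters only through an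
  exponential linear in \<open>z\<close>, mixing over \<open>z\<close> amounts to one more Laplace
  transform.\<close>

lemma noise_laplace:
  fixes W :: "real measure" and z s l :: real
  assumes W: "prob_space W" "sets W = sets borel"
    and lap: "\<And>s. s > -1/2 \<Longrightarrow> (\<integral>\<^sup>+x. ennreal (exp (- (s * x))) \<partial>W) = ennreal ((1 + 2 * s) powr (- b))"
    and z: "z \<ge> 0" and s: "s \<ge> 0" and l: "l > 0"
  shows "(\<integral>\<^sup>+y. ennreal (exp (- (s * ((sqrt l * fst y + sqrt (2 * z))\<^sup>2 / 2 + l * snd y / 2)))) \<partial>(std_normal_distribution \<Otimes>\<^sub>M W))
    = ennreal ((1 + l * s) powr (- (b + 1 / 2)) * exp (- (z * (s / (1 + l * s)))))"
proof -
  interpret W: prob_space W by fact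
  note W(2)[measurable_cong]
  have pos: "1 + l * s > 0" using s l by (simp add: add_pos_nonneg)
  have "(\<integral>\<^sup>+y. ennreal (exp (- (s * ((sqrt l * fst y + sqrt (2 * z))\<^sup>2 / 2 + l * snd y / 2)))) \<partial>(std_normal_distribution \<Otimes>\<^sub>M W))
     = (\<integral>\<^sup>+x. (\<integral>\<^sup>+v. ennreal (exp (- (s * (sqrt l * x + sqrt (2 * z))\<^sup>2 / 2))) * ennreal (exp (- (s * l / 2 * v))) \<partial>W) \<partial>std_normal_distribution)"
    by (subst W.nn_integral_fst[symmetric]) (auto simp: ennreal_mult'[symmetric] exp_add[symmetric] field_simps intro!: nn_integral_cong)
  also have "\<dots> = (\<integral>\<^sup>+x. ennreal (exp (- (s * (sqrt l * x + sqrt (2 * z))\<^sup>2 / 2))) \<partial>std_normal_distribution) * (\<integral>\<^sup>+v. ennreal (exp (- (s * l / 2 * v))) \<partial>W)"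
    by (simp add: nn_integral_cmult nn_integral_multc)
  also have "(\<integral>\<^sup>+x. ennreal (exp (- (s * (sqrt l * x + sqrt (2 * z))\<^sup>2 / 2))) \<partial>std_normal_distribution)
     = ennreal ((1 + l * s) powr (-1/2) * exp (- (z * (s / (1 + l * s)))))"
  proof -
    have "2 * z * w / 2 = z * w" for w by simp
    then have "(sqrt l)\<^sup>2 = l" "(sqrt (2 * z))\<^sup>2 * (s / (1 + l * s)) / 2 = z * (s / (1 + l * s))"
      using l z by (simp_all only: real_sqrt_pow2 less_imp_le mult_nonneg_nonneg zero_le_numeral)
    then show ?thesis
      using nn_integral_normal_exp_square[of "sqrt l" s "sqrt (2 * z)"] pos by metis
  qed
  also have "(\<integral>\<^sup>+v. ennreal (exp (- (s * l / 2 * v))) \<partial>W) = ennreal ((1 + l * s) powr (- b))"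
  proof -
    have "s * l / 2 > - 1 / 2" using pos by (simp add: mult.commute)
    from lap[OF this] show ?thesis by (simp add: mult.commute)
  qed
  also have "ennreal ((1 + l * s) powr (-1/2) * exp (- (z * (s / (1 + l * s))))) * ennreal ((1 + l * s) powr (- b))
     = ennreal ((1 + l * s) powr (- (b + 1 / 2)) * exp (- (z * (s / (1 + l * s)))))"
    by (simp add: ennreal_mult'[symmetric] powr_add[symmetric] mult_ac)
  finally show ?thesis .
qed

section \<open>The explicit process\<close>

text \<open>For a = k / 2 this is the law of half the squared lengths of the k-dimensional Gaussian
  vectors sqrt (l i) \<xi>_i + sqrt 2 \<zeta>, rotated so that \<zeta> lies along the first axis; z
  is the squared length of \<zeta>. Another \<open>a\<close> changes only the law of z. The limits
  are established conditionally on each z > 0, so they hold for every shape.\<close>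

lemma laplace_rep_base:
  fixes l :: "nat \<Rightarrow> real" and \<beta> a :: real and k N :: nat
  assumes l: "\<And>n. l n > 0" and l0: "l \<longlonglongrightarrow> 0" and lL: "(\<lambda>n. l n * ln (real (n + N))) \<longlonglongrightarrow> \<beta>"
    and \<beta>: "\<beta> \<ge> 0" and N: "N \<ge> 2" and a: "a > 0" and k: "k \<ge> 1"
  shows "laplace_rep (sqrt_lil (\<lambda>n. sqrt (l n * ln (real (n + N)))) \<beta>)
    (\<lambda>n s. (1 + 2 * (\<Sum>i<n. s i / (1 + case_nat 0 l i * s i))) powr (- a)
       * (\<Prod>i<n. (1 + case_nat 0 l i * s i) powr (- (real k / 2)))) 1"
proof -
  obtain Z where Z: "prob_space Z" "sets Z = sets (borel :: real measure)" "AE z in Z. 0 < z"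
    and lapZ: "\<And>s. s > -1/2 \<Longrightarrow> (\<integral>\<^sup>+x. ennreal (exp (- (s * x))) \<partial>Z) = ennreal ((1 + 2 * s) powr (- a))"
    using ex_gamma_distribution[of a] a by (auto elim!: AE_mp)
  obtain W where W: "prob_space W" "sets W = sets (borel :: real measure)" "AE v in W. 0 \<le> v"
    and lapW: "\<And>s. s > -1/2 \<Longrightarrow> (\<integral>\<^sup>+x. ennreal (exp (- (s * x))) \<partial>W) = ennreal ((1 + 2 * s) powr (- ((real k - 1) / 2)))"
  proof -
    have "(real k - 1) / 2 \<ge> 0" using k by simp
    from ex_gamma_distribution[OF this] obtain W where W: "prob_space W" "sets W = sets (borel :: real measure)"
      "AE v in W. 0 \<le> v \<and> ((real k - 1) / 2 > 0 \<longrightarrow> 0 < v)"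
      "\<forall>s>-1/2. (\<integral>\<^sup>+x. ennreal (exp (- (s * x))) \<partial>W) = ennreal ((1 + 2 * s) powr (- ((real k - 1) / 2)))" by blast
    have "AE v in W. 0 \<le> v" using W(3) by (rule AE_mp) auto
    with W show ?thesis by (intro that) auto
  qed
  interpret Z: prob_space Z by fact
  interpret W: prob_space W by fact
  interpret G: prob_space std_normal_distribution by (rule prob_space_std_normal_distribution)
  interpret GW: pair_prob_space std_normal_distribution W ..
  let ?N = "std_normal_distribution \<Otimes>\<^sub>M W"
  let ?P = "PiM UNIV (\<lambda>_::nat. ?N)"
  interpret P: product_prob_space "\<lambda>_::nat. ?N" UNIV ..
  interpret ZP: pair_prob_space Z ?P ..
  note Z(2)[measurable_cong] W(2)[measurable_cong]
  define L where "L n = ln (real (n + N))" for n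
  have L: "L n > 0" for n using N by (simp add: L_def)
  have Linf: "filterlim L at_top sequentially" unfolding L_def
    by (intro filterlim_compose[OF ln_at_top] filterlim_compose[OF filterlim_real_sequentially] filterlim_add_const_nat_at_top)
  \<comment> \<open>A level below which the chi-square part stays with positive probability; at such
    indices its contribution to the lower limit is negligible.\<close>
  obtain v0 :: real where v0: "v0 \<ge> 0" "measure W {..v0} > 0"
  proof -
    have "(\<lambda>n::nat. measure W {..real n}) \<longlonglongrightarrow> measure W (\<Union>n. {..real n})"
      by (intro W.finite_Lim_measure_incseq) (auto simp: incseq_def W(2))
    moreover have "(\<Union>n::nat. {..real n}) = space W"
      using real_arch_simple by (auto simp: sets_eq_imp_space_eq[OF W(2)])
    ultimately have "(\<lambda>n::nat. measure W {..real n}) \<longlonglongrightarrow> 1" using W.prob_space by simp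
    then have "\<forall>\<^sub>F n in sequentially. 0 < measure W {..real n}" by (rule order_tendstoD) simp
    then obtain n where "0 < measure W {..real n}" by (auto simp: eventually_sequentially)
    then show ?thesis by (intro that[of "real n"]) auto
  qed
  define x where "x z \<omega> = case_nat z (\<lambda>i. (sqrt (l i) * fst (\<omega> i) + sqrt (2 * z))\<^sup>2 / 2 + l i * snd (\<omega> i) / 2)"
    for z and \<omega> :: "nat \<Rightarrow> real \<times> real"
  \<comment> \<open>The first component is constantly 1: this is a genuine probability law, hence
    the bound 1.\<close>
  define T where "T y = (1::real, x (fst y) (snd y))" for y
  have T[measurable]: "T \<in> measurable (Z \<Otimes>\<^sub>M ?P) (borel \<Otimes>\<^sub>M seq_borel)"
  proof -
    have "(\<lambda>y. x (fst y) (snd y) i) \<in> borel_measurable (Z \<Otimes>\<^sub>M ?P)" for i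
      by (cases i) (simp_all add: x_def)
    then show ?thesis unfolding T_def
      by (intro measurable_Pair measurable_PiM_single') (auto simp: space_PiM)
  qed
  have "AE \<omega> in ?P. \<forall>m::nat. \<forall>\<^sub>F n in sequentially. (fst (\<omega> n))\<^sup>2 + snd (\<omega> n) \<le> 2 * (1 + inverse (real (Suc m))) * L n"
    unfolding L_def by (subst AE_all_countable) (intro allI noise_upper[OF W(1,2) lapW _ N], auto)
  moreover have "AE \<omega> in ?P. \<forall>\<theta>\<in>\<rat> \<inter> {0<..<1}. \<exists>\<^sub>F n in sequentially.
      \<theta> * sqrt (2 * L n) \<le> fst (\<omega> n) \<and> fst (\<omega> n) \<le> \<theta> * sqrt (2 * L n) + 1 \<and> snd (\<omega> n) \<le> v0"
  proof (subst AE_ball_countable)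
    show "\<forall>\<theta>\<in>\<rat> \<inter> {0<..<1}. AE \<omega> in ?P. \<exists>\<^sub>F n in sequentially.
      \<theta> * sqrt (2 * L n) \<le> fst (\<omega> n) \<and> fst (\<omega> n) \<le> \<theta> * sqrt (2 * L n) + 1 \<and> snd (\<omega> n) \<le> v0"
      unfolding L_def
    proof (intro ballI noise_lower[OF W(1,2) v0(2) _ _ N])
      fix \<theta> :: real and n assume "\<theta> \<in> \<rat> \<inter> {0<..<1}"
      then have "0 \<le> \<theta> * sqrt (2 * ln (real (n + N)))" using L[of n] by (auto simp: L_def)
      then show "{\<theta> * sqrt (2 * ln (real (n + N)))..\<theta> * sqrt (2 * ln (real (n + N))) + 1} \<subseteq> {- (\<theta> * sqrt (2 * ln (real (n + N))) + 1)..\<theta> * sqrt (2 * ln (real (n + N))) + 1}"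
        by auto
    qed auto
  qed (auto intro: countable_rat countable_Int1)
  \<comment> \<open>The window below zero. The \<open>- 1 + 1\<close> is left unreduced so that its
    upper end has the form \<open>u n + 1\<close>.\<close>
  moreover have "AE \<omega> in ?P. \<forall>\<theta>\<in>\<rat> \<inter> {0<..<1}. \<exists>\<^sub>F n in sequentially.
      - (\<theta> * sqrt (2 * L n)) - 1 \<le> fst (\<omega> n) \<and> fst (\<omega> n) \<le> - (\<theta> * sqrt (2 * L n)) - 1 + 1 \<and> snd (\<omega> n) \<le> v0"
  proof (subst AE_ball_countable)
    show "\<forall>\<theta>\<in>\<rat> \<inter> {0<..<1}. AE \<omega> in ?P. \<exists>\<^sub>F n in sequentially.
      - (\<theta> * sqrt (2 * L n)) - 1 \<le> fst (\<omega> n) \<and> fst (\<omega> n) \<le> - (\<theta> * sqrt (2 * L n)) - 1 + 1 \<and> snd (\<omega> n) \<le> v0"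
      unfolding L_def
    proof (intro ballI noise_lower[OF W(1,2) v0(2) _ _ N])
      fix \<theta> :: real and n assume "\<theta> \<in> \<rat> \<inter> {0<..<1}"
      then have "0 \<le> \<theta> * sqrt (2 * ln (real (n + N)))" using L[of n] by (auto simp: L_def)
      then show "{- (\<theta> * sqrt (2 * ln (real (n + N)))) - 1..- (\<theta> * sqrt (2 * ln (real (n + N)))) - 1 + 1} \<subseteq> {- (\<theta> * sqrt (2 * ln (real (n + N))) + 1)..\<theta> * sqrt (2 * ln (real (n + N))) + 1}"
        by auto
    qed auto
  qed (auto intro: countable_rat countable_Int1)
  moreover have "AE \<omega> in ?P. \<forall>i. 0 \<le> snd (\<omega> i)"
  proof (subst AE_all_countable, intro allI)
    fix i
    have "AE y in ?N. 0 \<le> snd y"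
    proof (rule GW.AE_pair_measure)
      show "{y \<in> space ?N. 0 \<le> snd y} \<in> sets ?N" by measurable
    qed (use W(3) in simp)
    then show "AE \<omega> in ?P. 0 \<le> snd (\<omega> i)"
      by (intro AE_PiM_component[where M="\<lambda>_. ?N" and P="\<lambda>y. 0 \<le> snd y"]) (auto intro: GW.P.prob_space_axioms)
  qed
  ultimately have aeP: "AE \<omega> in ?P. (\<forall>i. 0 \<le> x z \<omega> i) \<and> sqrt_lil (\<lambda>n. sqrt (l n * L n)) \<beta> (x z \<omega>)" if z: "z > 0" for z
  proof eventually_elim
    case (elim \<omega>)
    have "0 \<le> x z \<omega> i" for i using elim z less_imp_le[OF l] by (cases i) (auto simp: x_def)
    moreover have "sqrt_lil (\<lambda>n. sqrt (l n * L n)) \<beta> (x z \<omega>)"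
    proof (rule sqrt_lil_of_noise[where \<eta>="\<lambda>n. fst (\<omega> n)" and V="\<lambda>n. snd (\<omega> n)" and z=z and ?v0.0=v0])
      fix \<theta> :: real assume th: "\<theta> \<in> \<rat>" "0 < \<theta>" "\<theta> < 1"
      then have th': "\<theta> \<in> \<rat> \<inter> {0<..<1}" by simp
      show "\<exists>\<^sub>F n in sequentially. \<theta> * sqrt (2 * L n) \<le> fst (\<omega> n)"
        by (rule frequently_elim1[OF elim(2)[rule_format, OF th']]) simp
      show "\<exists>\<^sub>F n in sequentially. - (\<theta> * sqrt (2 * L n)) - 1 \<le> fst (\<omega> n) \<and> fst (\<omega> n) \<le> - (\<theta> * sqrt (2 * L n)) \<and> snd (\<omega> n) \<le> v0"
        by (rule frequently_elim1[OF elim(3)[rule_format, OF th']]) simp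
    qed (use elim(1,4) l l0 L Linf lL[folded L_def] \<beta> z v0 in \<open>auto simp: x_def\<close>)
    ultimately show ?case by blast
  qed
  have ae: "AE y in Z \<Otimes>\<^sub>M ?P. \<bar>fst (T y)\<bar> \<le> 1 \<and> (\<forall>i. 0 \<le> snd (T y) i) \<and> sqrt_lil (\<lambda>n. sqrt (l n * L n)) \<beta> (snd (T y))"
  proof (rule ZP.AE_pair_measure)
    show "{y \<in> space (Z \<Otimes>\<^sub>M ?P). \<bar>fst (T y)\<bar> \<le> 1 \<and> (\<forall>i. 0 \<le> snd (T y) i) \<and> sqrt_lil (\<lambda>n. sqrt (l n * L n)) \<beta> (snd (T y))} \<in> sets (Z \<Otimes>\<^sub>M ?P)"
      by measurable
    show "AE z in Z. AE \<omega> in ?P. \<bar>fst (T (z, \<omega>))\<bar> \<le> 1 \<and> (\<forall>i. 0 \<le> snd (T (z, \<omega>)) i) \<and> sqrt_lil (\<lambda>n. sqrt (l n * L n)) \<beta> (snd (T (z, \<omega>)))"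
    proof (rule AE_mp[OF Z(3)], rule AE_I2, rule impI)
      fix z :: real assume "0 < z"
      from aeP[OF this] show "AE \<omega> in ?P. \<bar>fst (T (z, \<omega>))\<bar> \<le> 1 \<and> (\<forall>i. 0 \<le> snd (T (z, \<omega>)) i) \<and> sqrt_lil (\<lambda>n. sqrt (l n * L n)) \<beta> (snd (T (z, \<omega>)))"
        by (simp add: T_def)
    qed
  qed
  show ?thesis unfolding L_def[symmetric]
  proof (rule laplace_repI[where Q="distr (Z \<Otimes>\<^sub>M ?P) (borel \<Otimes>\<^sub>M seq_borel) T"])
    show "prob_space (distr (Z \<Otimes>\<^sub>M ?P) (borel \<Otimes>\<^sub>M seq_borel) T)" by (rule ZP.prob_space_distr[OF T])
    show "AE y in distr (Z \<Otimes>\<^sub>M ?P) (borel \<Otimes>\<^sub>M seq_borel) T. \<bar>fst y\<bar> \<le> 1 \<and> (\<forall>i. 0 \<le> snd y i) \<and> sqrt_lil (\<lambda>n. sqrt (l n * L n)) \<beta> (snd y)"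
      using ae by (subst AE_distr_iff) auto
  next
    fix n :: nat and s :: "nat \<Rightarrow> real" assume s: "\<And>i. 0 \<le> s i" "\<And>i. i \<ge> n \<Longrightarrow> s i = 0"
    define A where "A = (\<Sum>i<n. s i / (1 + case_nat 0 l i * s i))"
    define D where "D = (\<Prod>i<n. (1 + case_nat 0 l i * s i) powr (- (real k / 2)))"
    have pos: "1 + case_nat 0 l i * s i > 0" for i
      using s(1)[of i] less_imp_le[OF l] by (auto split: nat.split intro!: add_pos_nonneg)
    have A0: "A \<ge> 0" unfolding A_def using s pos by (intro sum_nonneg divide_nonneg_pos) auto
    have D0: "D \<ge> 0" unfolding D_def by (intro prod_nonneg) auto
    \<comment> \<open>Given \<open>z\<close>, the transform splits into \<open>D\<close>, which is
      free of \<open>z\<close>, and an exponential with rate \<open>A\<close>; integrating over the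
      gamma law of \<open>z\<close> is then evaluating its transform at \<open>A\<close>.\<close>
    have inner: "(\<integral>\<^sup>+\<omega>. ennreal (exp (- (\<Sum>i<n. s i * x z \<omega> i))) \<partial>?P) = ennreal (D * exp (- (A * z)))" if z: "z > 0" for z
    proof (cases n)
      case 0
      then show ?thesis by (simp add: A_def D_def P.P.emeasure_space_1)
    next
      case (Suc m)
      define \<phi> where "\<phi> i y = exp (- (s (Suc i) * ((sqrt (l i) * fst y + sqrt (2 * z))\<^sup>2 / 2 + l i * snd y / 2)))" for i and y :: "real \<times> real"
      have \<phi>[measurable]: "\<phi> i \<in> borel_measurable ?N" for i unfolding \<phi>_def by measurable
      have "(\<integral>\<^sup>+\<omega>. ennreal (exp (- (\<Sum>i<n. s i * x z \<omega> i))) \<partial>?P) = (\<integral>\<^sup>+\<omega>. ennreal (exp (- (s 0 * z))) * (\<Prod>i<m. ennreal (\<phi> i (\<omega> i))) \<partial>?P)"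
      proof (rule nn_integral_cong)
        fix \<omega>
        have "exp (- (\<Sum>i<n. s i * x z \<omega> i)) = exp (- (s 0 * z)) * (\<Prod>i<m. \<phi> i (\<omega> i))"
        proof -
          define S where "S = (\<Sum>i<m. s (Suc i) * ((sqrt (l i) * fst (\<omega> i) + sqrt (2 * z))\<^sup>2 / 2 + l i * snd (\<omega> i) / 2))"
          have "(\<Sum>i<n. s i * x z \<omega> i) = s 0 * z + S"
            unfolding Suc sum.lessThan_Suc_shift S_def by (simp add: x_def)
          moreover have "exp (- S) = (\<Prod>i<m. \<phi> i (\<omega> i))"
            unfolding S_def \<phi>_def sum_negf[symmetric] by (rule exp_sum) simp
          ultimately show ?thesis by (simp only: minus_add_distrib exp_add)
        qed
        then show "ennreal (exp (- (\<Sum>i<n. s i * x z \<omega> i))) = ennreal (exp (- (s 0 * z))) * (\<Prod>i<m. ennreal (\<phi> i (\<omega> i)))"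
          by (simp add: prod_ennreal ennreal_mult' \<phi>_def)
      qed
      also have "\<dots> = ennreal (exp (- (s 0 * z))) * (\<Prod>i<m. \<integral>\<^sup>+y. ennreal (\<phi> i y) \<partial>?N)"
        by (subst nn_integral_cmult) (auto simp: nn_integral_PiM_UNIV_prod[OF GW.P.prob_space_axioms, where \<phi>="\<lambda>i y. ennreal (\<phi> i y)"])
      also have "(\<Prod>i<m. \<integral>\<^sup>+y. ennreal (\<phi> i y) \<partial>?N) = (\<Prod>i<m. ennreal ((1 + l i * s (Suc i)) powr (- (real k / 2)) * exp (- (z * (s (Suc i) / (1 + l i * s (Suc i)))))))"
      proof (intro prod.cong refl)
        fix i
        have "(real k - 1) / 2 + 1 / 2 = real k / 2" by (simp add: field_simps)
        then show "(\<integral>\<^sup>+y. ennreal (\<phi> i y) \<partial>?N) = ennreal ((1 + l i * s (Suc i)) powr (- (real k / 2)) * exp (- (z * (s (Suc i) / (1 + l i * s (Suc i))))))"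
          unfolding \<phi>_def using noise_laplace[OF W(1,2) lapW less_imp_le[OF z] s(1) l, of "Suc i" i] by (simp only:)
      qed
      also have "\<dots> = ennreal (\<Prod>i<m. (1 + l i * s (Suc i)) powr (- (real k / 2)) * exp (- (z * (s (Suc i) / (1 + l i * s (Suc i))))))"
        by (rule prod_ennreal) auto
      also have "ennreal (exp (- (s 0 * z))) * \<dots> = ennreal (D * exp (- (A * z)))"
      proof -
        have D: "D = (\<Prod>i<m. (1 + l i * s (Suc i)) powr (- (real k / 2)))"
          unfolding D_def Suc prod.lessThan_Suc_shift by simp
        have "A = s 0 + (\<Sum>i<m. s (Suc i) / (1 + l i * s (Suc i)))"
          unfolding A_def Suc sum.lessThan_Suc_shift by simp
        then have "exp (- (A * z)) = exp (- (s 0 * z)) * exp (\<Sum>i<m. - (z * (s (Suc i) / (1 + l i * s (Suc i)))))"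
          by (simp add: exp_add[symmetric] sum_negf sum_distrib_left algebra_simps)
        then have "exp (- (A * z)) = exp (- (s 0 * z)) * (\<Prod>i<m. exp (- (z * (s (Suc i) / (1 + l i * s (Suc i))))))"
          by (simp add: exp_sum)
        then show ?thesis by (simp add: D prod.distrib ennreal_mult'[symmetric] mult_ac)
      qed
      finally show ?thesis .
    qed
    have m: "(\<lambda>y. exp (- (\<Sum>i<n. s i * snd (T y) i))) \<in> borel_measurable (Z \<Otimes>\<^sub>M ?P)" by measurable
    have "(\<integral>\<^sup>+y. ennreal (exp (- (\<Sum>i<n. s i * snd (T y) i))) \<partial>(Z \<Otimes>\<^sub>M ?P)) = (\<integral>\<^sup>+z. \<integral>\<^sup>+\<omega>. ennreal (exp (- (\<Sum>i<n. s i * snd (T (z, \<omega>)) i))) \<partial>?P \<partial>Z)"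
      by (rule P.P.nn_integral_fst[symmetric]) measurable
    also have "\<dots> = (\<integral>\<^sup>+z. ennreal D * ennreal (exp (- (A * z))) \<partial>Z)"
      by (rule nn_integral_cong_AE, rule AE_mp[OF Z(3)]) (auto intro!: AE_I2 simp: T_def inner D0 ennreal_mult')
    also have "\<dots> = ennreal D * (\<integral>\<^sup>+z. ennreal (exp (- (A * z))) \<partial>Z)"
      by (rule nn_integral_cmult) measurable
    also have "\<dots> = ennreal (D * (1 + 2 * A) powr (- a))"
      using lapZ[of A] A0 D0 by (simp add: ennreal_mult')
    finally have nn: "(\<integral>\<^sup>+y. ennreal (exp (- (\<Sum>i<n. s i * snd (T y) i))) \<partial>(Z \<Otimes>\<^sub>M ?P)) = ennreal (D * (1 + 2 * A) powr (- a))" .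
    have "(\<integral>y. fst y * exp (- (\<Sum>i<n. s i * snd y i)) \<partial>distr (Z \<Otimes>\<^sub>M ?P) (borel \<Otimes>\<^sub>M seq_borel) T)
       = (\<integral>y. exp (- (\<Sum>i<n. s i * snd (T y) i)) \<partial>(Z \<Otimes>\<^sub>M ?P))"
      by (subst integral_distr[OF T]) (auto simp: T_def)
    also have "\<dots> = D * (1 + 2 * A) powr (- a)"
      using D0 by (subst integral_eq_nn_integral[OF m]) (auto simp: nn)
    finally show "(1 + 2 * (\<Sum>i<n. s i / (1 + case_nat 0 l i * s i))) powr (- a) * (\<Prod>i<n. (1 + case_nat 0 l i * s i) powr (- (real k / 2)))
       = 1 * (\<integral>y. fst y * exp (- (\<Sum>i<n. s i * snd y i)) \<partial>distr (Z \<Otimes>\<^sub>M ?P) (borel \<Otimes>\<^sub>M seq_borel) T)"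
      unfolding A_def[symmetric] D_def[symmetric] by simp
  qed auto
qed

section \<open>Rank-two perturbations\<close>

text \<open>Everything in the expansion is uniformly small except \<open>A\<close>, which is
  unbounded in \<open>s\<close> and must not survive as a factor. It is confined to powers of
  \<open>1 + 2 * A\<close>, which the gamma law absorbs; this is why \<open>base\<close> covers all
  shapes \<open>\<alpha> + real j\<close>.\<close>

lemma laplace_rep_rank_two:
  fixes lam p q :: "nat \<Rightarrow> real" and \<alpha> :: real
  defines "A \<equiv> \<lambda>n s. \<Sum>i<n. s i / (1 + lam i * s i)"
  defines "D \<equiv> \<lambda>n s. (1 + A n s) * (1 + (\<Sum>i<n. s i / (1 + lam i * s i) * ((1 - p i) * (1 - q i))))
      - (\<Sum>i<n. s i / (1 + lam i * s i) * (1 - p i)) * (\<Sum>i<n. s i / (1 + lam i * s i) * (1 - q i))"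
  assumes lam: "lam 0 = 0" "\<And>i. i > 0 \<Longrightarrow> lam i > 0"
    and p0: "p 0 = 0" "q 0 = 0" and p01: "\<And>i. 0 \<le> p i" "\<And>i. 0 \<le> q i" "\<And>i. q i \<le> 1"
    and sp: "summable (\<lambda>i. p i / lam i)" "(\<Sum>i. p i / lam i) \<le> 1 / 16"
    and sq: "summable (\<lambda>i. q i / lam i)" "(\<Sum>i. q i / lam i) \<le> 1 / 16"
    and G: "Measurable.pred seq_borel G"
    and inv: "\<And>i x e. i > 0 \<Longrightarrow> G x \<Longrightarrow> G (x(i := x i + e))"
    and base: "\<And>j::nat. laplace_rep G (\<lambda>n s. (1 + 2 * A n s) powr (- (\<alpha> + real j)) * (\<Prod>i<n. (1 + lam i * s i) powr (- \<alpha>))) 1"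
  shows "\<exists>C. laplace_rep G (\<lambda>n s. ((\<Prod>i<n. 1 + lam i * s i) * D n s) powr (- \<alpha>)) C"
proof -
  define W where "W w n s = (\<Sum>i<n. w i * (1 - 1 / (1 + lam i * s i)))" for w s :: "nat \<Rightarrow> real" and n
  define u v r where "u i = p i / lam i" and "v i = q i / lam i" and "r i = p i * q i / lam i" for i
  have l0: "lam i \<ge> 0" for i using lam by (cases "i = 0") (auto intro: less_imp_le)
  have u: "summable u" "suminf u \<le> 1 / 16" "u 0 = 0" "\<And>i. u i \<ge> 0"
    using sp p0 p01 l0 by (auto simp: u_def[abs_def])
  have v: "summable v" "suminf v \<le> 1 / 16" "v 0 = 0" "\<And>i. v i \<ge> 0"
    using sq p0 p01 l0 by (auto simp: v_def[abs_def])
  have ru: "r i \<le> u i" for i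
    unfolding r_def u_def using p01(1,3)[of i] l0[of i] by (intro divide_right_mono) (auto intro: mult_left_le)
  have r0: "r 0 = 0" "\<And>i. r i \<ge> 0" using p0 p01 l0 by (auto simp: r_def)
  have sr: "summable r" by (rule summable_comparison_test'[OF u(1), of 0]) (use ru r0 in auto)
  have r: "summable r" "suminf r \<le> 1 / 16" "r 0 = 0" "\<And>i. r i \<ge> 0"
    using sr r0 suminf_le[OF ru sr u(1)] u(2) by auto
  have Wrep: "laplace_rep G (\<lambda>n s. W w n s * \<Phi> n s) (C / 8)"
    if w: "summable w" "suminf w \<le> 1 / 16" "w 0 = 0" "\<And>i. w i \<ge> 0" and \<Phi>: "laplace_rep G \<Phi> C" for w \<Phi> C
  proof -
    have C: "C \<ge> 0" using \<Phi> by (rule laplace_repE)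
    have "laplace_rep G (\<lambda>n s. W w n s * \<Phi> n s) (2 * suminf w * C)"
      unfolding W_def by (rule laplace_rep_mult_sum[OF \<Phi> lam(2) G inv]) (use w in auto)
    from laplace_rep_scale[OF this, of 1 "C / 8"] show ?thesis
      using mult_right_mono[OF w(2) C] G by simp
  qed
  have Wb: "0 \<le> W w n s" "W w n s \<le> 1 / 16"
    if w: "summable w" "suminf w \<le> 1 / 16" "w 0 = 0" "\<And>i. w i \<ge> 0" and s: "\<And>i. s i \<ge> 0" for w s n
  proof -
    have a: "0 \<le> 1 - 1 / (1 + lam i * s i)" "1 - 1 / (1 + lam i * s i) \<le> 1" for i
      using l0[of i] s[of i] by (auto simp: divide_le_eq_1 add_nonneg_nonneg)
    show "0 \<le> W w n s" unfolding W_def using a w by (intro sum_nonneg mult_nonneg_nonneg) auto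
    have "W w n s \<le> (\<Sum>i<n. w i)" unfolding W_def using a w by (intro sum_mono mult_left_le) auto
    also have "\<dots> \<le> suminf w" using w by (intro sum_le_suminf) auto
    finally show "W w n s \<le> 1 / 16" using w by simp
  qed
  define E where "E j n s = (1 + 2 * A n s) powr (- (\<alpha> + real j)) * (\<Prod>i<n. (1 + lam i * s i) powr (- \<alpha>))" for j :: nat and n s
  \<comment> \<open>In the determinant the squares of \<open>A\<close> cancel, and the only product
    with \<open>A\<close> left is \<open>A * W r\<close>. Writing \<open>(1 + A) * W r\<close> as
    \<open>(1 + 2 * A) * W r / 2 + W r / 2\<close> lets \<open>1 + 2 * A\<close> be factored out;
    hence the two halves of \<open>W r\<close>.\<close>
  define Y where "Y n s = - W r n s / 2 + (W u n s + W v n s - W r n s / 2 + W u n s * W v n s) / (1 + 2 * A n s)" for n s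
  have A0: "A n s \<ge> 0" if "\<And>i. s i \<ge> 0" for n s
    unfolding A_def using that l0 by (intro sum_nonneg divide_nonneg_nonneg) (auto intro: add_nonneg_nonneg)
  \<comment> \<open>Division by \<open>1 + 2 * A\<close> raises the gamma shape by one, so the
    induction on powers of \<open>Y\<close> runs over all \<open>j\<close> at once.\<close>
  have E_Suc: "E (Suc j) n s = E j n s / (1 + 2 * A n s)" if "\<And>i. s i \<ge> 0" for j n s
  proof -
    have "1 + 2 * A n s > 0" using A0[of s n, OF that] by simp
    then have "(1 + 2 * A n s) powr (- (\<alpha> + real (Suc j))) = (1 + 2 * A n s) powr (- (\<alpha> + real j)) / (1 + 2 * A n s)"
    proof -
      have e: "- (\<alpha> + real (Suc j)) = - (\<alpha> + real j) - 1" by simp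
      show ?thesis unfolding e powr_diff using \<open>1 + 2 * A n s > 0\<close> by simp
    qed
    then show ?thesis by (simp add: E_def)
  qed
  have YE: "laplace_rep G (\<lambda>n s. Y n s ^ m * E j n s) ((1 / 2) ^ m)" for m j
  proof (induction m arbitrary: j)
    case 0
    then show ?case using base by (simp add: E_def)
  next
    case (Suc m)
    \<comment> \<open>Multiplying by one \<open>W\<close> costs 2 * (1/16) = 1/8. The five terms of
      \<open>Y\<close> together cost 1/16 + 1/16 + 1/64 + 1/8 + 1/8 = 25/64, which is at most
      1/2.\<close>
    let ?c = "(1 / 2) ^ m :: real"
    let ?F = "\<lambda>j n s. Y n s ^ m * E j n s"
    have 1: "laplace_rep G (\<lambda>n s. (- 1 / 2) * (W r n s * ?F j n s)) (?c / 16)"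
      by (rule laplace_rep_scale[OF Wrep[OF r Suc.IH] _ G]) simp
    have 2: "laplace_rep G (\<lambda>n s. (- 1 / 2) * (W r n s * ?F (Suc j) n s)) (?c / 16)"
      by (rule laplace_rep_scale[OF Wrep[OF r Suc.IH] _ G]) simp
    have 3: "laplace_rep G (\<lambda>n s. W u n s * (W v n s * ?F (Suc j) n s)) (?c / 8 / 8)"
      by (intro Wrep u v Suc.IH)
    have "laplace_rep G (\<lambda>n s. (((- 1 / 2) * (W r n s * ?F j n s) + (- 1 / 2) * (W r n s * ?F (Suc j) n s))
       + W u n s * (W v n s * ?F (Suc j) n s)) + (W u n s * ?F (Suc j) n s + W v n s * ?F (Suc j) n s))
       ((?c / 16 + ?c / 16 + ?c / 8 / 8) + (?c / 8 + ?c / 8))"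
      by (intro laplace_rep_add 1 2 3 Wrep[OF u] Wrep[OF v] Suc.IH G)
    from laplace_rep_scale[OF this, of 1 "(1 / 2) ^ Suc m"]
    have "laplace_rep G (\<lambda>n s. 1 * ((((- 1 / 2) * (W r n s * ?F j n s) + (- 1 / 2) * (W r n s * ?F (Suc j) n s))
       + W u n s * (W v n s * ?F (Suc j) n s)) + (W u n s * ?F (Suc j) n s + W v n s * ?F (Suc j) n s)))
       ((1 / 2) ^ Suc m)"
      using G by simp
    then show ?case
      by (rule laplace_rep_cong) (simp add: Y_def E_Suc algebra_simps add_divide_distrib diff_divide_distrib)
  qed
  \<comment> \<open>The Taylor coefficients of (1 - Y) powr (-\<alpha>), with the sign of
    \<open>(- Y) ^ m\<close> moved into them. Their series has radius of convergence at least 1, so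
    the weights \<open>\<bar>c m\<bar> * (1 / 2) ^ m\<close> are summable.\<close>
  define c where "c m = ((- \<alpha>) gchoose m) * (- 1) ^ m" for m
  define C where "C = (\<Sum>m. \<bar>c m\<bar> * (1 / 2) ^ m)"
  have "laplace_rep G (\<lambda>n s. \<Sum>m. c m * (Y n s ^ m * E 0 n s)) C"
    unfolding C_def
  proof (rule laplace_rep_suminf[OF _ _ G])
    show "laplace_rep G (\<lambda>n s. c m * (Y n s ^ m * E 0 n s)) (\<bar>c m\<bar> * (1 / 2) ^ m)" for m
      by (rule laplace_rep_scale[OF YE _ G]) simp
    have "summable (\<lambda>m. norm (((- \<alpha>) gchoose m) * (1 / 2 :: real) ^ m))"
      by (rule abs_summable_in_conv_radius) (simp add: conv_radius_gchoose)
    then show "summable (\<lambda>m. \<bar>c m\<bar> * (1 / 2) ^ m)" by (simp add: c_def abs_mult power_abs)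
  qed
  then have "laplace_rep G (\<lambda>n s. ((\<Prod>i<n. 1 + lam i * s i) * D n s) powr (- \<alpha>)) C"
  proof (rule laplace_rep_cong)
    fix n :: nat and s :: "nat \<Rightarrow> real" assume s: "\<And>i. 0 \<le> s i"
    note b = Wb[of u s n, OF u s] Wb[of v s n, OF v s] Wb[of r s n, OF r s]
    have A1: "1 + 2 * A n s \<ge> 1" using A0[of s n, OF s] by simp
    have "0 \<le> W u n s * W v n s" using b by simp
    moreover have "W u n s * W v n s \<le> 1 / 16 * (1 / 16)" by (rule mult_mono) (use b in simp_all)
    ultimately have uv: "0 \<le> W u n s * W v n s" "W u n s * W v n s \<le> 1 / 16 * (1 / 16)" .
    define t where "t = (W u n s + W v n s - W r n s / 2 + W u n s * W v n s) / (1 + 2 * A n s)"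
    have "\<bar>t\<bar> \<le> \<bar>W u n s + W v n s - W r n s / 2 + W u n s * W v n s\<bar>"
      unfolding t_def abs_divide using A1 by (simp add: divide_le_eq mult_left_le mult_le_cancel_left1)
    also have "\<dots> \<le> 1 / 4" using b uv by linarith
    finally have Y1: "\<bar>Y n s\<bar> < 1" unfolding Y_def t_def[symmetric] using b by linarith
    \<comment> \<open>At coordinate 0 both \<open>lam 0\<close> and \<open>x\<close> vanish, and
      division by zero gives 0, so the identity holds there too.\<close>
    have aw: "s i / (1 + lam i * s i) * x = x / lam i * (1 - 1 / (1 + lam i * s i))" if "i = 0 \<Longrightarrow> x = 0" for i x
    proof (cases "i = 0")
      case False
      then have "lam i > 0" "1 + lam i * s i > 0" using lam(2)[of i] s[of i] by (auto intro!: add_pos_nonneg)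
      then show ?thesis by (simp add: field_simps)
    qed (use that in simp)
    let ?a = "\<lambda>i. s i / (1 + lam i * s i)"
    have au: "(\<Sum>i<n. ?a i * p i) = W u n s" unfolding W_def u_def by (intro sum.cong refl aw) (use p0 in auto)
    have av: "(\<Sum>i<n. ?a i * q i) = W v n s" unfolding W_def v_def by (intro sum.cong refl aw) (use p0 in auto)
    have ar: "(\<Sum>i<n. ?a i * (p i * q i)) = W r n s" unfolding W_def r_def by (intro sum.cong refl aw) (use p0 in auto)
    have expand: "(\<Sum>i<n. a i * ((1 - p i) * (1 - q i))) = (\<Sum>i<n. a i) - (\<Sum>i<n. a i * p i) - (\<Sum>i<n. a i * q i) + (\<Sum>i<n. a i * (p i * q i))"
      "(\<Sum>i<n. a i * (1 - p i)) = (\<Sum>i<n. a i) - (\<Sum>i<n. a i * p i)"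
      "(\<Sum>i<n. a i * (1 - q i)) = (\<Sum>i<n. a i) - (\<Sum>i<n. a i * q i)" for a :: "nat \<Rightarrow> real"
      by (simp_all add: sum_subtractf[symmetric] sum.distrib[symmetric] algebra_simps)
    have "D n s = (1 + A n s) * (1 + (A n s - W u n s - W v n s + W r n s)) - (A n s - W u n s) * (A n s - W v n s)"
      unfolding D_def A_def expand au av ar ..
    also have "\<dots> = (1 + 2 * A n s) * (1 + W r n s / 2) - (1 + 2 * A n s) * t"
    proof -
      have "(1 + 2 * A n s) * t = W u n s + W v n s - W r n s / 2 + W u n s * W v n s" using A1 by (simp add: t_def)
      then show ?thesis by (simp add: algebra_simps)
    qed
    also have "\<dots> = (1 + 2 * A n s) * (1 - Y n s)" unfolding Y_def t_def[symmetric] by (simp add: algebra_simps)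
    finally have D: "D n s = (1 + 2 * A n s) * (1 - Y n s)" .
    have "(\<lambda>m. ((- \<alpha>) gchoose m) * (- Y n s) ^ m) sums (1 + (- Y n s)) powr (- \<alpha>)"
      by (rule gen_binomial_real) (use Y1 in simp)
    then have "(\<lambda>m. c m * Y n s ^ m) sums (1 - Y n s) powr (- \<alpha>)"
      by (simp add: c_def power_minus[of "Y n s"] mult_ac)
    then have "(\<lambda>m. c m * Y n s ^ m * E 0 n s) sums ((1 - Y n s) powr (- \<alpha>) * E 0 n s)" by (rule sums_mult2)
    then have "(\<Sum>m. c m * (Y n s ^ m * E 0 n s)) = (1 - Y n s) powr (- \<alpha>) * E 0 n s"
      by (simp add: sums_iff mult.assoc)
    also have "\<dots> = ((\<Prod>i<n. 1 + lam i * s i) * D n s) powr (- \<alpha>)"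
    proof -
      have "(\<Prod>i<n. (1 + lam i * s i) powr (- \<alpha>)) = (\<Prod>i<n. 1 + lam i * s i) powr (- \<alpha>)"
        by (rule prod_powr_distrib[symmetric])
      moreover have "0 \<le> (\<Prod>i<n. 1 + lam i * s i)"
        by (intro prod_nonneg) (use l0 s in \<open>auto intro: add_nonneg_nonneg\<close>)
      ultimately show ?thesis using A1 Y1 by (simp add: D E_def powr_mult)
    qed
    finally show "(\<Sum>m. c m * (Y n s ^ m * E 0 n s)) = ((\<Prod>i<n. 1 + lam i * s i) * D n s) powr (- \<alpha>)" .
  qed
  then show ?thesis ..
qed

section \<open>Determinants of low-rank perturbations\<close>

text \<open>The matrix determinant lemma: the block matrix with rows (D, U) and (-V, 1) is made
  block triangular once by a unipotent factor on the right and once by one on the left. The two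
  resulting expressions for its determinant are the two sides.\<close>

lemma det_add_mult:
  fixes d :: "nat \<Rightarrow> 'a :: field"
  assumes U: "U \<in> carrier_mat n m" and V: "V \<in> carrier_mat m n" and d: "\<And>i. i < n \<Longrightarrow> d i \<noteq> 0"
  shows "Determinant.det (mat_diag n d + U * V)
    = (\<Prod>i<n. d i) * Determinant.det (1\<^sub>m m + V * (mat_diag n (\<lambda>i. 1 / d i) * U))"
proof -
  let ?D = "mat_diag n d" and ?E = "mat_diag n (\<lambda>i. 1 / d i)"
  have D: "?D \<in> carrier_mat n n" "?E \<in> carrier_mat n n" by auto
  have ED: "?E * ?D = 1\<^sub>m n"
  proof -
    have "?E * ?D = mat_diag n (\<lambda>i. 1 / d i * d i)" by simp
    also have "\<dots> = 1\<^sub>m n" using d by (intro eq_matI) (auto simp: mat_diag_def)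
    finally show ?thesis .
  qed
  note UV = mult_carrier_mat[OF U V] and EU = mult_carrier_mat[OF D(2) U] and VE = mult_carrier_mat[OF V D(2)]
  note VEU = mult_carrier_mat[OF V EU]
  have 1: "four_block_mat ?D U (- V) (1\<^sub>m m) * four_block_mat (1\<^sub>m n) (0\<^sub>m n m) V (1\<^sub>m m)
      = four_block_mat (?D + U * V) U (0\<^sub>m m n) (1\<^sub>m m)"
    using U V D UV by (subst mult_four_block_mat[of _ n n _ m _ m _ _ n _ m])
      (auto simp: uminus_l_inv_mat right_mult_one_mat[OF D(1)] right_mult_zero_mat[OF D(1)])
  have 2: "four_block_mat (1\<^sub>m n) (0\<^sub>m n m) (- (V * ?E)) (1\<^sub>m m) * four_block_mat ?D U (0\<^sub>m m n) (1\<^sub>m m + V * (?E * U))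
      = four_block_mat ?D U (- V) (1\<^sub>m m)"
  proof -
    have "- (V * ?E) * ?D = - (V * ?E * ?D)" by (rule uminus_mult_left_mat) (simp add: mat_diag_def)
    then have a: "- (V * ?E) * ?D = - V"
      unfolding assoc_mult_mat[OF V D(2) D(1)] ED right_mult_one_mat[OF V] .
    have "- (V * ?E) * U = - (V * ?E * U)" by (rule uminus_mult_left_mat) (use U in \<open>simp add: mat_diag_def\<close>)
    then have "- (V * ?E) * U = - (V * (?E * U))"
      unfolding assoc_mult_mat[OF V D(2) U] .
    moreover have "- W + (1\<^sub>m m + W) = 1\<^sub>m m" if "W \<in> carrier_mat m m" for W :: "'a mat"
      by (intro eq_matI) (use that in auto)
    ultimately have b: "- (V * ?E) * U + (1\<^sub>m m + V * (?E * U)) = 1\<^sub>m m"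
      using VEU by simp
    have "four_block_mat (1\<^sub>m n) (0\<^sub>m n m) N (1\<^sub>m m) * four_block_mat ?D U (0\<^sub>m m n) S = four_block_mat ?D U (N * ?D) (N * U + S)"
      if "N \<in> carrier_mat m n" "S \<in> carrier_mat m m" for N S
      using mult_four_block_mat[OF one_carrier_mat zero_carrier_mat that(1) one_carrier_mat D(1) U zero_carrier_mat that(2)] that U D
      by (simp add: left_mult_one_mat[OF D(1)])
    from this[of "- (V * ?E)" "1\<^sub>m m + V * (?E * U)"] show ?thesis
      unfolding a b using VE VEU by simp
  qed
  have "Determinant.det (four_block_mat (?D + U * V) U (0\<^sub>m m n) (1\<^sub>m m)) = Determinant.det (?D + U * V)"
    using U V D UV by (subst det_four_block_mat_lower_left_zero[of _ n _ m]) auto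
  moreover have "Determinant.det (four_block_mat (1\<^sub>m n) (0\<^sub>m n m) V (1\<^sub>m m)) = 1"
    using V by (subst det_four_block_mat_upper_right_zero[of _ n _ m]) auto
  moreover have "Determinant.det (four_block_mat (1\<^sub>m n) (0\<^sub>m n m) (- (V * ?E)) (1\<^sub>m m)) = 1"
    using VE by (subst det_four_block_mat_upper_right_zero[of _ n _ m]) auto
  moreover have "Determinant.det (four_block_mat ?D U (0\<^sub>m m n) (1\<^sub>m m + V * (?E * U))) = Determinant.det ?D * Determinant.det (1\<^sub>m m + V * (?E * U))"
    using U D VEU by (subst det_four_block_mat_lower_left_zero[of _ n _ m]) auto
  moreover have "Determinant.det (four_block_mat ?D U (- V) (1\<^sub>m m) * four_block_mat (1\<^sub>m n) (0\<^sub>m n m) V (1\<^sub>m m))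
     = Determinant.det (four_block_mat ?D U (- V) (1\<^sub>m m)) * Determinant.det (four_block_mat (1\<^sub>m n) (0\<^sub>m n m) V (1\<^sub>m m))"
    using U V D by (intro det_mult[of _ "n + m"]) auto
  moreover have "Determinant.det (four_block_mat (1\<^sub>m n) (0\<^sub>m n m) (- (V * ?E)) (1\<^sub>m m) * four_block_mat ?D U (0\<^sub>m m n) (1\<^sub>m m + V * (?E * U)))
     = Determinant.det (four_block_mat (1\<^sub>m n) (0\<^sub>m n m) (- (V * ?E)) (1\<^sub>m m)) * Determinant.det (four_block_mat ?D U (0\<^sub>m m n) (1\<^sub>m m + V * (?E * U)))"
    using U V D VE VEU by (intro det_mult[of _ "n + m"]) auto
  moreover have "Determinant.det ?D = (\<Prod>i<n. d i)"
  proof -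
    have "Determinant.det ?D = prod_list (diag_mat ?D)"
      by (rule det_upper_triangular[of _ n]) (auto simp: mat_diag_def upper_triangular_def)
    also have "\<dots> = (\<Prod>i<n. d i)"
      by (simp add: prod_list_diag_prod mat_diag_def atLeast0LessThan)
    finally show ?thesis .
  qed
  ultimately show ?thesis unfolding 1 2 by simp
qed

lemma det_2_mat:
  fixes A :: "'a :: comm_ring_1 mat"
  assumes A: "A \<in> carrier_mat 2 2"
  shows "Determinant.det A = A $$ (0, 0) * A $$ (1, 1) - A $$ (0, 1) * A $$ (1, 0)"
proof -
  have dims: "dim_row A = 2" "dim_col A = 2" using A by auto
  have "Determinant.det A = (\<Sum>i<2. A $$ (i, 0) * cofactor A i 0)"
    using laplace_expansion_column[OF A, of 0] by simp
  then show ?thesis using dims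
    by (simp add: numeral_2_eq_2 cofactor_def mat_delete_def det_single)
qed

lemma det_diag_plus_rank_two:
  fixes lam f g s :: "nat \<Rightarrow> real"
  assumes K: "\<And>i j. i < n \<Longrightarrow> j < n \<Longrightarrow> K i j = (if i = j then lam i else 0) + 1 + f i * g j"
    and d: "\<And>i. i < n \<Longrightarrow> 1 + lam i * s i \<noteq> 0"
  shows "Determinant.det (1\<^sub>m n + Matrix.mat n n (\<lambda>(i, j). K i j) * mat_diag n s)
    = (\<Prod>i<n. 1 + lam i * s i) *
      ((1 + (\<Sum>i<n. s i / (1 + lam i * s i))) * (1 + (\<Sum>i<n. s i / (1 + lam i * s i) * (f i * g i)))
       - (\<Sum>i<n. s i / (1 + lam i * s i) * f i) * (\<Sum>i<n. s i / (1 + lam i * s i) * g i))"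
proof -
  \<comment> \<open>The two columns of \<open>U\<close> are 1 and \<open>f\<close>; the two rows of
    \<open>V\<close> are 1 and \<open>g\<close>, each scaled by \<open>s\<close>. Thus
    \<open>U * V\<close> is the rank-two part of the kernel times the diagonal matrix of
    \<open>s\<close>.\<close>
  define U where "U = Matrix.mat n 2 (\<lambda>(i, j). if j = 0 then 1 else f i)"
  define V where "V = Matrix.mat 2 n (\<lambda>(i, j). if i = 0 then s j else g j * s j)"
  have U: "U \<in> carrier_mat n 2" and V: "V \<in> carrier_mat 2 n" by (auto simp: U_def V_def)
  let ?d = "\<lambda>i. 1 + lam i * s i"
  have "1\<^sub>m n + Matrix.mat n n (\<lambda>(i, j). K i j) * mat_diag n s = mat_diag n ?d + U * V"
    by (subst mat_diag_mult_right[of _ n n])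
      (auto simp: U_def V_def mat_diag_def K scalar_prod_def numeral_2_eq_2 algebra_simps intro!: eq_matI)
  then have "Determinant.det (1\<^sub>m n + Matrix.mat n n (\<lambda>(i, j). K i j) * mat_diag n s)
     = (\<Prod>i<n. ?d i) * Determinant.det (1\<^sub>m 2 + V * (mat_diag n (\<lambda>i. 1 / ?d i) * U))"
    using det_add_mult[OF U V, of ?d] d by simp
  also have "Determinant.det (1\<^sub>m 2 + V * (mat_diag n (\<lambda>i. 1 / ?d i) * U)) =
      (1 + (\<Sum>i<n. s i / (1 + lam i * s i))) * (1 + (\<Sum>i<n. s i / (1 + lam i * s i) * (f i * g i)))
       - (\<Sum>i<n. s i / (1 + lam i * s i) * f i) * (\<Sum>i<n. s i / (1 + lam i * s i) * g i)"
    using U V by (subst det_2_mat)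
      (auto simp: mat_diag_mult_left[of _ n 2] U_def V_def scalar_prod_def atLeast0LessThan mult_ac)
  finally show ?thesis .
qed

section \<open>The law of the iterated logarithm\<close>

text \<open>Equal Laplace transforms make the law of \<open>x\<close> and the signed measure agree
  on the complement of \<open>G\<close>, where the signed measure is zero.\<close>

lemma AE_of_laplace_rep:
  fixes x :: "'w \<Rightarrow> nat \<Rightarrow> real"
  assumes M: "prob_space M" and rep: "laplace_rep G \<Phi> C"
    and G[measurable]: "Measurable.pred seq_borel G"
    and x[measurable]: "\<And>i. (\<lambda>w. x w i) \<in> borel_measurable M"
    and x0: "\<And>w i. w \<in> space M \<Longrightarrow> 0 \<le> x w i"
    and laplace: "\<And>n s. \<lbrakk>\<And>i. 0 \<le> s i; \<And>i. i \<ge> n \<Longrightarrow> s i = 0\<rbrakk> \<Longrightarrow>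
      (\<integral>w. exp (- (\<Sum>i<n. s i * x w i)) \<partial>M) = \<Phi> n s"
  shows "AE w in M. G (x w)"
proof -
  interpret M: prob_space M by fact
  from rep obtain Q where C: "0 \<le> C" and Q: "prob_space Q" and sQ[measurable_cong]: "sets Q = sets (borel \<Otimes>\<^sub>M seq_borel)"
    and ae: "AE y in Q. \<bar>fst y\<bar> \<le> 1 \<and> (\<forall>i. 0 \<le> snd y i) \<and> G (snd y)"
    and \<Phi>: "\<And>n s. \<lbrakk>\<And>i. 0 \<le> s i; \<And>i. i \<ge> n \<Longrightarrow> s i = 0\<rbrakk> \<Longrightarrow>
       \<Phi> n s = C * (\<integral>y. fst y * exp (- (\<Sum>i<n. s i * snd y i)) \<partial>Q)"
    by (rule laplace_repE) blast
  interpret Q: prob_space Q by fact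
  \<comment> \<open>The coordinates \<open>snd y i\<close> are nonnegative only almost everywhere,
    whereas \<open>signed_laplace_unique\<close> asks for it on the whole space; the absolute value
    changes them on a null set.\<close>
  define a where "a y i = \<bar>snd y i\<bar>" for y :: "real \<times> (nat \<Rightarrow> real)" and i :: nat
  have am[measurable]: "(\<lambda>y. a y i) \<in> borel_measurable Q" for i unfolding a_def by measurable
  have xm[measurable]: "x \<in> measurable M seq_borel" and am'[measurable]: "a \<in> measurable Q seq_borel"
    using x am by (auto intro!: measurable_PiM_single' simp: space_PiM)
  have aea: "AE y in Q. a y = snd y" using ae by (rule AE_mp) (auto intro!: AE_I2 simp: a_def fun_eq_iff)
  define B where "B = {x \<in> space seq_borel. \<not> G x}"
  have B[measurable]: "B \<in> sets seq_borel" unfolding B_def by measurable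
  have "(\<integral>w. 1 * indicator B (x w) \<partial>M) = (\<integral>y. (C * fst y) * indicator B (a y) \<partial>Q)"
  proof (rule signed_laplace_unique[OF _ _ x am x0 _ _ B])
    show "integrable Q (\<lambda>y. C * fst y)"
    proof (rule Q.integrable_const_bound[where B=C])
      show "AE y in Q. norm (C * fst y) \<le> C"
        using ae by (rule AE_mp) (auto intro!: AE_I2 mult_left_le simp: abs_mult C)
    qed measurable
    fix n and s :: "nat \<Rightarrow> real" assume s: "\<And>i. 0 \<le> s i" "\<And>i. n \<le> i \<Longrightarrow> s i = 0"
    have "(\<integral>y. (C * fst y) * exp (- (\<Sum>i<n. s i * a y i)) \<partial>Q) = (\<integral>y. C * (fst y * exp (- (\<Sum>i<n. s i * snd y i))) \<partial>Q)"
      by (intro integral_cong_AE, measurable, rule AE_mp[OF aea]) (auto intro!: AE_I2)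
    also have "\<dots> = \<Phi> n s" by (simp only: integral_mult_right_zero \<Phi>[of s n, OF s])
    finally show "(\<integral>w. 1 * exp (- (\<Sum>i<n. s i * x w i)) \<partial>M) = (\<integral>y. (C * fst y) * exp (- (\<Sum>i<n. s i * a y i)) \<partial>Q)"
      using laplace[of s n, OF s] by simp
  qed (auto simp: a_def)
  also have "\<dots> = (\<integral>y. 0 \<partial>Q)"
  proof (rule integral_cong_AE)
    show "AE y in Q. (C * fst y) * indicator B (a y) = 0"
      using ae aea by eventually_elim (auto simp: B_def)
  qed measurable
  finally have "(\<integral>w. indicator (x -` B \<inter> space M) w \<partial>M) = (0 :: real)"
    by (subst Bochner_Integration.integral_cong[where g="\<lambda>w. 1 * indicator B (x w)"]) (auto simp: indicator_def)
  then have "measure M (x -` B \<inter> space M) = 0" by simp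
  then have "x -` B \<inter> space M \<in> null_sets M"
    using measurable_sets[OF xm B] by (auto simp: M.emeasure_eq_measure)
  then show ?thesis
    by (rule AE_I') (use measurable_space[OF xm] in \<open>auto simp: B_def\<close>)
qed

theorem theorem1p6:
  fixes T :: "real set"
    and lam f g :: "nat \<Rightarrow> real"
    and U :: "real \<Rightarrow> real \<Rightarrow> real"
    and M :: "'w measure"
    and X :: "real \<Rightarrow> 'w \<Rightarrow> real"
    and k :: nat
    and \<beta> :: real
  assumes T: "T = insert 0 {1 / real n | n. n \<ge> 2}"
    and lam_pos: "\<And>j. j \<ge> 2 \<Longrightarrow> lam j > 0"
    and f_bounds: "\<And>j. j \<ge> 2 \<Longrightarrow> 0 < f j \<and> f j < 1"
    and g_bounds: "\<And>j. j \<ge> 2 \<Longrightarrow> 0 < g j \<and> g j < 1"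
    and lam_lim: "lam \<longlonglongrightarrow> 0"
    and f_summable: "summable (\<lambda>j. (1 - f (j + 2)) / lam (j + 2))"
    and f_sum: "(\<Sum>j. (1 - f (j + 2)) / lam (j + 2)) < 1"
    and g_summable: "summable (\<lambda>j. (1 - g (j + 2)) / lam (j + 2))"
    and g_sum: "(\<Sum>j. (1 - g (j + 2)) / lam (j + 2)) < 1"
    and U_00: "U 0 0 = 2"
    and U_0j: "\<And>j. j \<ge> 2 \<Longrightarrow> U 0 (1 / real j) = 1 + g j"
    and U_i0: "\<And>i. i \<ge> 2 \<Longrightarrow> U (1 / real i) 0 = 1 + f i"
    and U_ij: "\<And>i j. i \<ge> 2 \<Longrightarrow> j \<ge> 2 \<Longrightarrow>
                 U (1 / real i) (1 / real j) = (if i = j then lam i else 0) + 1 + f i * g j"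
    and beta_lim: "(\<lambda>n. lam n * ln (real n)) \<longlonglongrightarrow> \<beta>"
    and beta_nonneg: "0 \<le> \<beta>"
    and k: "k \<ge> 1"
    and X: "permanental_process M (real k / 2) T U X"
  shows "AE w in M.
      limsup (\<lambda>n. ereal (\<bar>sqrt (X (1 / real n) w) - sqrt (X 0 w)\<bar> / sqrt (lam n * ln (real n)))) = 1
    \<and> limsup (\<lambda>n. ereal ((sqrt (X (1 / real n) w) - sqrt (X 0 w)) / sqrt (lam n * ln (real n)))) = 1
    \<and> liminf (\<lambda>n. ereal ((sqrt (X (1 / real n) w) - sqrt (X 0 w)) / sqrt (lam n * ln (real n)))) =
        ereal (if \<beta> = 0 then - 1 else - min (sqrt (X 0 w) / sqrt \<beta>) 1)"
proof -
  \<comment> \<open>The threshold 1/16 is the one under which multiplication by Y costs at most 1/2;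
    the finitely many indices cut off do not influence the limits.\<close>
  obtain Nf where Nf: "\<And>n. n \<ge> Nf \<Longrightarrow> norm (\<Sum>i. (1 - f (i + n + 2)) / lam (i + n + 2)) < 1 / 16"
    using suminf_exist_split[OF _ f_summable, of "1 / 16"] by auto
  obtain Ng where Ng: "\<And>n. n \<ge> Ng \<Longrightarrow> norm (\<Sum>i. (1 - g (i + n + 2)) / lam (i + n + 2)) < 1 / 16"
    using suminf_exist_split[OF _ g_summable, of "1 / 16"] by auto
  define N0 where "N0 = max Nf Ng"
  \<comment> \<open>The series are indexed from 0 with terms at \<open>j + 2\<close>, so their tails
    from \<open>N0\<close> on begin at index \<open>N0 + 2\<close> of the sequences.\<close>
  define N where "N = N0 + 2"
  have N: "N \<ge> 2" by (simp add: N_def)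
  have N2: "i + N \<ge> 2" for i using N by simp
  define l where "l n = lam (n + N)" for n
  \<comment> \<open>Coordinate 0 is the point 0 of \<open>T\<close>. It fits the general pattern
    with diagonal part 0 and f = g = 1, that is p = q = 0, which reproduces \<open>U 0 0 = 2\<close>
    and the mixed entries.\<close>
  define L p q t where "L = case_nat 0 l" and "p = case_nat 0 (\<lambda>i. 1 - f (i + N))"
    and "q = case_nat 0 (\<lambda>i. 1 - g (i + N))" and "t = case_nat 0 (\<lambda>i. 1 / real (i + N))"
  define G where "G = sqrt_lil (\<lambda>n. sqrt (l n * ln (real (n + N)))) \<beta>"
  have G: "Measurable.pred seq_borel G" unfolding G_def by measurable
  have l: "l n > 0" for n unfolding l_def by (rule lam_pos[OF N2])
  have L: "L 0 = 0" "\<And>i. i > 0 \<Longrightarrow> L i > 0" using l by (auto simp: L_def gr0_conv_Suc)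
  have L0: "L i \<ge> 0" for i using l by (cases i) (auto simp: L_def less_imp_le)
  have tail: "summable (\<lambda>i. case_nat 0 h i / L i)" "(\<Sum>i. case_nat 0 h i / L i) = (\<Sum>i. h i / l i)"
    if "summable (\<lambda>i. h i / l i)" for h
  proof -
    let ?u = "\<lambda>i. case_nat 0 h i / L i"
    have u: "?u (Suc i) = h i / l i" "?u 0 = 0" for i by (auto simp: L_def)
    show s: "summable ?u" using that by (subst summable_Suc_iff[symmetric]) (simp only: u)
    show "suminf ?u = (\<Sum>i. h i / l i)" using suminf_split_head[OF s] by (simp only: u diff_0_right)
  qed
  have sf: "summable (\<lambda>i. (1 - f (i + N)) / l i)" "(\<Sum>i. (1 - f (i + N)) / l i) \<le> 1 / 16"
    using summable_ignore_initial_segment[OF f_summable, of N0] Nf[of N0]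
    by (auto simp: N_def l_def N0_def add.assoc)
  have sg: "summable (\<lambda>i. (1 - g (i + N)) / l i)" "(\<Sum>i. (1 - g (i + N)) / l i) \<le> 1 / 16"
    using summable_ignore_initial_segment[OF g_summable, of N0] Ng[of N0]
    by (auto simp: N_def l_def N0_def add.assoc)
  define A where "A n s = (\<Sum>i<n. s i / (1 + L i * s i))" for n and s :: "nat \<Rightarrow> real"
  define D where "D n s = (1 + A n s) * (1 + (\<Sum>i<n. s i / (1 + L i * s i) * ((1 - p i) * (1 - q i))))
      - (\<Sum>i<n. s i / (1 + L i * s i) * (1 - p i)) * (\<Sum>i<n. s i / (1 + L i * s i) * (1 - q i))" for n s
  have "\<exists>C. laplace_rep G (\<lambda>n s. ((\<Prod>i<n. 1 + L i * s i) * D n s) powr (- (real k / 2))) C"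
    unfolding D_def A_def
  proof (rule laplace_rep_rank_two[where lam=L and p=p and q=q and G=G])
    show "summable (\<lambda>i. p i / L i)" "(\<Sum>i. p i / L i) \<le> 1 / 16"
      unfolding p_def using tail[OF sf(1)] sf(2) by simp_all
    show "summable (\<lambda>i. q i / L i)" "(\<Sum>i. q i / L i) \<le> 1 / 16"
      unfolding q_def using tail[OF sg(1)] sg(2) by simp_all
    show "0 \<le> p i" "0 \<le> q i" "q i \<le> 1" for i
      using f_bounds[OF N2, of "i - 1"] g_bounds[OF N2, of "i - 1"] by (cases i; simp add: p_def q_def)+
    show "G (x(i := x i + e))" if "i > 0" "G x" for i x e
      using that unfolding G_def by (intro sqrt_lil_update)
    show "laplace_rep G (\<lambda>n s. (1 + 2 * (\<Sum>i<n. s i / (1 + L i * s i))) powr (- (real k / 2 + real j))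
       * (\<Prod>i<n. (1 + L i * s i) powr (- (real k / 2)))) 1" for j :: nat
      unfolding G_def L_def
    proof (rule laplace_rep_base[OF l _ _ beta_nonneg N _ k])
      show "l \<longlonglongrightarrow> 0" unfolding l_def using lam_lim by (rule LIMSEQ_ignore_initial_segment)
      show "(\<lambda>n. l n * ln (real (n + N))) \<longlonglongrightarrow> \<beta>"
        unfolding l_def using beta_lim by (rule LIMSEQ_ignore_initial_segment)
    qed (use k in simp)
  qed (use L G in \<open>auto simp: p_def q_def\<close>)
  then obtain C where rep: "laplace_rep G (\<lambda>n s. ((\<Prod>i<n. 1 + L i * s i) * D n s) powr (- (real k / 2))) C" ..
  have vec: "permanental_vector M (real k / 2) (length ts)
          (Matrix.mat (length ts) (length ts) (\<lambda>(i, j). U (ts ! i) (ts ! j))) (\<lambda>i. X (ts ! i))"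
    if "distinct ts" "set ts \<subseteq> T" for ts
    using X that unfolding permanental_process_def by blast
  \<comment> \<open>The empty family is admissible and already asserts that \<open>M\<close> is a
    probability space.\<close>
  have M: "prob_space M" using vec[of "[]"] by (simp add: permanental_vector_def)
  have tT: "t i \<in> T" for i
  proof (cases i)
    case (Suc m)
    then have "t i = 1 / real (m + N)" by (simp add: t_def)
    then show ?thesis unfolding T using N2[of m] by blast
  qed (simp add: t_def T)
  have tinj: "inj t"
  proof (rule injI)
    fix i j assume "t i = t j"
    then show "i = j" using N by (cases i; cases j) (auto simp: t_def divide_simps)
  qed
  have Xt: "X (t i) \<in> borel_measurable M" "w \<in> space M \<Longrightarrow> 0 \<le> X (t i) w" for i w
    using vec[of "[t i]"] tT[of i] by (auto simp: permanental_vector_def)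
  have Ut: "U (t i) (t j) = (if i = j then L i else 0) + 1 + (1 - p i) * (1 - q j)" for i j
    using U_00 U_0j[OF N2] U_i0[OF N2] U_ij[OF N2 N2]
    by (cases i; cases j) (auto simp: t_def L_def l_def p_def q_def)
  have "AE w in M. G (\<lambda>i. X (t i) w)"
  proof (rule AE_of_laplace_rep[OF M rep G])
    fix n and s :: "nat \<Rightarrow> real" assume s: "\<And>i. 0 \<le> s i"
    let ?ts = "map t [0..<n]"
    have "permanental_vector M (real k / 2) n (Matrix.mat n n (\<lambda>(i, j). U (?ts ! i) (?ts ! j))) (\<lambda>i. X (?ts ! i))"
      using vec[of ?ts] tT tinj by (auto simp: distinct_map inj_on_def inj_def)
    then have "(\<integral>w. exp (- (\<Sum>i<n. s i * X (?ts ! i) w)) \<partial>M)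
       = 1 / Determinant.det (1\<^sub>m n + Matrix.mat n n (\<lambda>(i, j). U (?ts ! i) (?ts ! j)) * mat_diag n s) powr (real k / 2)"
      using s unfolding permanental_vector_def by blast
    moreover have "(\<Sum>i<n. s i * X (?ts ! i) w) = (\<Sum>i<n. s i * X (t i) w)" for w
      by (intro sum.cong) auto
    moreover have "Determinant.det (1\<^sub>m n + Matrix.mat n n (\<lambda>(i, j). U (?ts ! i) (?ts ! j)) * mat_diag n s)
       = (\<Prod>i<n. 1 + L i * s i) * D n s"
      unfolding D_def A_def
    proof (rule det_diag_plus_rank_two)
      show "1 + L i * s i \<noteq> 0" for i using mult_nonneg_nonneg[OF L0 s, of i i] by linarith
    qed (simp add: Ut)
    ultimately show "(\<integral>w. exp (- (\<Sum>i<n. s i * X (t i) w)) \<partial>M) = ((\<Prod>i<n. 1 + L i * s i) * D n s) powr (- (real k / 2))"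
      by (simp add: powr_minus_divide)
  qed (use Xt in auto)
  then show ?thesis
  proof (rule AE_mp, intro AE_I2 impI)
    \<comment> \<open>Shifting by \<open>N\<close> leaves upper and lower limits unchanged; in
      particular the terms with n = 0 and n = 1, which belong to no point 1 / n of \<open>T\<close>,
      do not matter.\<close>
    fix w assume "G (\<lambda>i. X (t i) w)"
    then show "limsup (\<lambda>n. ereal (\<bar>sqrt (X (1 / real n) w) - sqrt (X 0 w)\<bar> / sqrt (lam n * ln (real n)))) = 1
    \<and> limsup (\<lambda>n. ereal ((sqrt (X (1 / real n) w) - sqrt (X 0 w)) / sqrt (lam n * ln (real n)))) = 1
    \<and> liminf (\<lambda>n. ereal ((sqrt (X (1 / real n) w) - sqrt (X 0 w)) / sqrt (lam n * ln (real n)))) =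
        ereal (if \<beta> = 0 then - 1 else - min (sqrt (X 0 w) / sqrt \<beta>) 1)"
      unfolding G_def sqrt_lil_def t_def l_def
      using limsup_shift_k[of "\<lambda>n. ereal (\<bar>sqrt (X (1 / real n) w) - sqrt (X 0 w)\<bar> / sqrt (lam n * ln (real n)))" N]
        limsup_shift_k[of "\<lambda>n. ereal ((sqrt (X (1 / real n) w) - sqrt (X 0 w)) / sqrt (lam n * ln (real n)))" N]
        liminf_shift_k[of "\<lambda>n. ereal ((sqrt (X (1 / real n) w) - sqrt (X 0 w)) / sqrt (lam n * ln (real n)))" N]
      by (simp only: nat.case)
  qed
qed

end
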